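(* Let $X$ be a connected finite simple graph on at least four vertices, with adjacency matrix $A$, and let $H(t)=\exp(iAt)$. If there is perfect state transfer between distinct vertices $u$ and $v$ of $X$ (i.e. $|H(\tau)_{u,v}|=1$ for some real $\tau$), then neither $(X,u)$ nor $(X,v)$ is controllable.
   Context: For a vertex $w$ of a graph on $n$ vertices, the walk matrix $W_w$ is the $n\times n$ matrix with columns $e_w,Ae_w,\dots,A^{n-1}e_w$ ($e_w$ the standard basis vector of $w$); $(X,w)$ is controllable (equivalently, $w$ is controllable) if $W_w$ is invertible. *)

theory Defs
  imports
    Complex_Main
    "Graph_Theory.Pair_Digraph"
    "Graph_Theory.Digraph_Component"
    "Jordan_Normal_Form.Jordan_Normal_Form"
begin

text \<open>
  A finite simple graph is a \<open>pair_graph\<close>: a finite, symmetric, loop-free set of arcs given as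
  ordered pairs, so that an edge is a pair of opposite arcs.  Matrices whose rows or columns belong
  to vertices are written with respect to an enumeration \<open>vs\<close> of the vertex set, that is, a
  distinct list with \<open>set vs = pverts G\<close>.
\<close>

definition vertex_index :: "'a list \<Rightarrow> 'a \<Rightarrow> nat" where
  "vertex_index vs w = (THE i. i < length vs \<and> vs ! i = w)"

lemma vertex_index_nth:
  assumes "distinct vs" "i < length vs"
  shows "vertex_index vs (vs ! i) = i"
  unfolding vertex_index_def using assms by (auto simp: nth_eq_iff_index_eq)

definition adjacency_mat :: "'a list \<Rightarrow> 'a pair_pre_digraph \<Rightarrow> real mat" where
  "adjacency_mat vs G =
     mat (length vs) (length vs) (\<lambda>(i, j). if (vs ! i, vs ! j) \<in> parcs G then 1 else 0)"

definition walk_mat :: "'a list \<Rightarrow> 'a pair_pre_digraph \<Rightarrow> 'a \<Rightarrow> real mat" where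
  "walk_mat vs G w =
     mat_of_cols (length vs)
       (map (\<lambda>k. (adjacency_mat vs G ^\<^sub>m k) *\<^sub>v unit_vec (length vs) (vertex_index vs w))
         [0..<length vs])"

definition controllable :: "'a list \<Rightarrow> 'a pair_pre_digraph \<Rightarrow> 'a \<Rightarrow> bool" where
  "controllable vs G w \<longleftrightarrow> invertible_mat (walk_mat vs G w)"

text \<open>
  The exponential of a square matrix is the entrywise sum of the power series; the series converges
  by \<open>mat_exp_summable\<close> below.
\<close>

definition mat_exp :: "complex mat \<Rightarrow> complex mat" where
  "mat_exp M = mat (dim_row M) (dim_row M) (\<lambda>ij. \<Sum>k. (M ^\<^sub>m k) $$ ij / fact k)"

lemma norm_bound_pow_mat:
  fixes M :: "complex mat"
  assumes M: "M \<in> carrier_mat n n" and b: "norm_bound M b"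
  shows "norm_bound (M ^\<^sub>m k) ((b * of_nat n) ^ k)"
proof (induction k)
  case 0
  then show ?case using M by (auto simp: norm_bound_def)
next
  case (Suc k)
  from norm_bound_mult[OF pow_carrier_mat[OF M] M Suc b]
  show ?case by (simp add: ac_simps)
qed

lemma mat_exp_summable:
  fixes M :: "complex mat"
  assumes M: "M \<in> carrier_mat n n" and "i < n" "j < n"
  shows "summable (\<lambda>k. (M ^\<^sub>m k) $$ (i, j) / fact k)"
proof -
  obtain b where b: "norm_bound M b"
    using norm_bound_max by blast
  have "norm ((M ^\<^sub>m k) $$ (i, j) / fact k) \<le> (b * of_nat n) ^ k /\<^sub>R fact k" for k
  proof -
    have "norm ((M ^\<^sub>m k) $$ (i, j)) \<le> (b * of_nat n) ^ k"
      using norm_bound_pow_mat[OF M b, of k] pow_carrier_mat[OF M, of k] assms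
      unfolding norm_bound_def by (metis carrier_matD)
    then show ?thesis
      by (simp add: norm_divide divide_right_mono flip: divide_inverse_commute)
  qed
  then show ?thesis
    by (intro summable_comparison_test'[OF summable_exp_generic[of "b * of_nat n"]]) auto
qed

definition transition_mat :: "'a list \<Rightarrow> 'a pair_pre_digraph \<Rightarrow> real \<Rightarrow> complex mat" where
  "transition_mat vs G t =
     mat_exp ((\<i> * complex_of_real t) \<cdot>\<^sub>m map_mat complex_of_real (adjacency_mat vs G))"

definition perfect_state_transfer :: "'a list \<Rightarrow> 'a pair_pre_digraph \<Rightarrow> 'a \<Rightarrow> 'a \<Rightarrow> bool" where
  "perfect_state_transfer vs G u v \<longleftrightarrow>
     (\<exists>\<tau>. cmod (transition_mat vs G \<tau> $$ (vertex_index vs u, vertex_index vs v)) = 1)"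

end

theory Submission
  imports Defs "Jordan_Normal_Form.Schur_Decomposition"
begin

text \<open>
  Let \<open>A = \<Sum>\<^sub>r \<theta>\<^sub>r p\<^sub>r p\<^sub>r\<^sup>T\<close> with an orthonormal eigenbasis, and suppose that \<open>u\<close> is controllable.  Then
  the \<open>\<theta>\<^sub>r\<close> are distinct and no \<open>p\<^sub>r\<close> vanishes at \<open>u\<close>.  Perfect state transfer at time \<open>\<tau>\<close> is an
  equality case of the Cauchy--Schwarz inequality; it yields signs \<open>d\<^sub>r\<close> with
  \<open>p\<^sub>r(v) = d\<^sub>r p\<^sub>r(u)\<close> and \<open>exp(i\<tau>\<theta>\<^sub>r) = \<gamma> d\<^sub>r\<close>.  So \<open>\<theta>\<^sub>r = \<theta>\<^sub>0 + g k\<^sub>r\<close> with integers \<open>k\<^sub>r\<close> of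
  greatest common divisor 1, the parity of \<open>k\<^sub>r\<close> is determined by \<open>d\<^sub>r\<close>, and orthogonality of rows
  \<open>u\<close> and \<open>v\<close> gives \<open>\<Sum> p\<^sub>r(u)\<^sup>2 = 1/2\<close> over the odd \<open>k\<^sub>r\<close>.

  Since \<open>tr A = 0\<close>, \<open>tr A\<^sup>2\<close> is an integer and the \<open>\<theta>\<^sub>r\<close> are algebraic integers, \<open>N = g\<^sup>2\<close> is a positive
  integer.  The spread of \<open>n\<close> distinct integers together with \<open>tr A\<^sup>2 \<le> n(n-1)\<close> gives
  \<open>N(n+1) \<le> 12\<close>, so \<open>N \<le> 2\<close> for \<open>n \<ge> 4\<close>.  If \<open>N = 1\<close>, the eigenvalues are integers, and the integrality of
  all moments \<open>\<Sum>\<^sub>r p\<^sub>r(u)\<^sup>2 (\<theta>\<^sub>r - \<theta>\<^sub>0)\<^sup>j\<close> contradicts 2-adically the value \<open>1/2\<close> above.  If \<open>N = 2\<close>,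
  all \<open>\<theta>\<^sub>r\<close> are integer multiples of \<open>\<surd>2\<close> and \<open>n \<in> {4, 5}\<close>: for \<open>n = 4\<close> four distinct integers with sum
  zero have too large a sum of squares, and for \<open>n = 5\<close> the graph is complete and has the
  eigenvalue \<open>-1\<close>.
\<close>

subsection \<open>Spectral decomposition of real symmetric matrices\<close>

text \<open>Schur triangularisation puts \<open>es\<close> on the diagonal of a similar matrix, and
  tr(XY) = tr(YX) makes the trace a similarity invariant.\<close>

lemma trace_eq_sum_list_eigenvalues:
  fixes M :: "complex mat"
  assumes M: "M \<in> carrier_mat n n" and es: "char_poly M = (\<Prod>e\<leftarrow>es. [:- e, 1:])"
  shows "(\<Sum>i<n. M $$ (i, i)) = sum_list es"
proof -
  obtain B P Q where "schur_decomposition M es = (B, P, Q)"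
    by (cases "schur_decomposition M es")
  from schur_decomposition[OF M es this]
  have w: "similar_mat_wit M B P Q" and d: "diag_mat B = es" by auto
  note W = similar_mat_witD2[OF M w]
  have trace_comm: "(\<Sum>i<n. (X * Y) $$ (i, i)) = (\<Sum>i<n. (Y * X) $$ (i, i))"
    if "X \<in> carrier_mat n n" "Y \<in> carrier_mat n n" for X Y :: "complex mat"
  proof -
    have "(\<Sum>i<n. (X * Y) $$ (i, i)) = (\<Sum>i<n. \<Sum>j<n. X $$ (i, j) * Y $$ (j, i))"
      using that by (intro sum.cong) (auto simp: scalar_prod_def lessThan_atLeast0)
    also have "\<dots> = (\<Sum>j<n. \<Sum>i<n. Y $$ (j, i) * X $$ (i, j))"
      by (subst sum.swap) (simp add: mult.commute)
    also have "\<dots> = (\<Sum>i<n. (Y * X) $$ (i, i))"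
      using that by (intro sum.cong) (auto simp: scalar_prod_def lessThan_atLeast0)
    finally show ?thesis .
  qed
  have "Q * (P * B) = Q * P * B"
    by (rule assoc_mult_mat[symmetric, OF W(7,6,5)])
  then have "Q * (P * B) = B"
    using W(2) left_mult_one_mat[OF W(5)] by simp
  then have "(\<Sum>i<n. M $$ (i, i)) = (\<Sum>i<n. B $$ (i, i))"
    using trace_comm[of "P * B" Q] W by simp
  also have "\<dots> = sum_list (diag_mat B)"
    using W by (simp add: diag_mat_def interv_sum_list_conv_sum_set_nat lessThan_atLeast0)
  finally show ?thesis using d by simp
qed

text \<open>Were \<open>c\<close> the only eigenvalue, the trace would be \<open>n * c\<close>.
  Symmetry makes the other eigenvalue real, so the real and imaginary parts of a complex eigenvector
  satisfy the same equation, and one of them is nonzero.\<close>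

lemma symmetric_eigenvector_avoiding:
  fixes a :: "nat \<Rightarrow> nat \<Rightarrow> real"
  assumes sym: "\<And>i j. i < n \<Longrightarrow> j < n \<Longrightarrow> a i j = a j i"
    and tr: "(\<Sum>i<n. a i i) \<noteq> real n * c"
  obtains l x where "l \<noteq> c" "\<exists>i<n. x i \<noteq> 0" "\<And>i. i < n \<Longrightarrow> (\<Sum>j<n. a i j * x j) = l * x i"
proof -
  define M where "M = mat n n (\<lambda>(i, j). complex_of_real (a i j))"
  have M: "M \<in> carrier_mat n n" by (simp add: M_def)
  obtain es where es: "char_poly M = (\<Prod>e\<leftarrow>es. [:- e, 1:])" "length es = n"
    using char_poly_factorized[OF M] by blast
  have "\<exists>e\<in>set es. e \<noteq> of_real c"
  proof (rule ccontr)
    assume "\<not> ?thesis"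
    then have "es = replicate n (of_real c)"
      using es(2) by (metis replicate_eqI)
    then have "sum_list es = of_real (real n * c)"
      by (simp add: sum_list_replicate)
    moreover have "(\<Sum>i<n. M $$ (i, i)) = of_real (\<Sum>i<n. a i i)"
      by (simp add: M_def)
    ultimately show False
      using trace_eq_sum_list_eigenvalues[OF M es(1)] tr by (metis of_real_eq_iff)
  qed
  then obtain e where e: "e \<in> set es" "e \<noteq> of_real c" by blast
  have "eigenvalue M e"
    unfolding eigenvalue_root_char_poly[OF M] es(1) using e(1) by (rule linear_poly_root)
  then obtain z where z: "z \<in> carrier_vec n" "z \<noteq> 0\<^sub>v n" "M *\<^sub>v z = e \<cdot>\<^sub>v z"
    using M unfolding eigenvalue_def eigenvector_def by auto
  have ev: "(\<Sum>j<n. of_real (a i j) * z $ j) = e * z $ i" if "i < n" for i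
  proof -
    have "(M *\<^sub>v z) $ i = (\<Sum>j<n. of_real (a i j) * z $ j)"
      using that z(1) by (auto simp: M_def scalar_prod_def lessThan_atLeast0)
    then show ?thesis using z that by simp
  qed
  obtain i0 where i0: "i0 < n" "z $ i0 \<noteq> 0"
    using z by (metis eq_vecI carrier_vecD index_zero_vec)
  define S where "S = (\<Sum>i<n. cnj (z $ i) * z $ i)"
  have S: "S = of_real (\<Sum>i<n. (cmod (z $ i))\<^sup>2)"
    by (simp add: S_def mult.commute flip: complex_norm_square)
  have "(\<Sum>i<n. (cmod (z $ i))\<^sup>2) \<noteq> 0"
    using i0 by (subst sum_nonneg_eq_0_iff) auto
  then have "S \<noteq> 0" unfolding S by (metis of_real_eq_0_iff)
  \<comment> \<open>This is the Hermitian form of \<open>M\<close> at \<open>z\<close>; by symmetry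
    it equals its own conjugate, so \<open>e\<close> is real.\<close>
  have eS: "e * S = (\<Sum>i<n. \<Sum>j<n. cnj (z $ i) * of_real (a i j) * z $ j)"
    unfolding S_def sum_distrib_left
    by (intro sum.cong refl) (simp add: ev[symmetric] sum_distrib_left mult.assoc mult.left_commute[of e])
  have "cnj (e * S) = (\<Sum>i<n. \<Sum>j<n. z $ i * of_real (a i j) * cnj (z $ j))"
    unfolding eS by simp
  also have "\<dots> = (\<Sum>j<n. \<Sum>i<n. z $ i * of_real (a i j) * cnj (z $ j))"
    by (rule sum.swap)
  also have "\<dots> = e * S"
    unfolding eS using sym by (intro sum.cong refl) (auto simp: mult_ac)
  finally have "cnj e = e"
    using \<open>S \<noteq> 0\<close> by (simp add: S)
  then have e_real: "e = of_real (Re e)"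
    by (metis Reals_cnj_iff of_real_Re)
  define l where "l = Re e"
  have el: "e = of_real l" using e_real by (simp add: l_def)
  have re: "(\<Sum>j<n. a i j * Re (z $ j)) = l * Re (z $ i)"
    and im: "(\<Sum>j<n. a i j * Im (z $ j)) = l * Im (z $ i)" if "i < n" for i
    using arg_cong[OF ev[OF that], of Re] arg_cong[OF ev[OF that], of Im] by (simp_all add: el)
  have l: "l \<noteq> c" using e(2) el by auto
  show thesis
  proof (cases "Re (z $ i0) = 0")
    case True
    then have "Im (z $ i0) \<noteq> 0" using i0 by (simp add: complex_eq_iff)
    then show ?thesis using that[of l "\<lambda>i. Im (z $ i)"] l im i0 by blast
  next
    case False
    then show ?thesis using that[of l "\<lambda>i. Re (z $ i)"] l re i0 by blast
  qed
qed

text \<open>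
  Deflation: adding \<open>(\<kappa> - \<theta>\<^sub>r) p\<^sub>r p\<^sub>r\<^sup>T\<close> for the eigenvectors \<open>p\<^sub>r\<close> found so far moves all of
  their eigenvalues to \<open>\<kappa>\<close>.  For a suitable \<open>\<kappa>\<close> the trace forces an eigenvalue different
  from \<open>\<kappa>\<close>, and its eigenvectors are orthogonal to all \<open>p\<^sub>r\<close>.
\<close>
lemma symmetric_orthonormal_eigenvectors:
  fixes a :: "nat \<Rightarrow> nat \<Rightarrow> real"
  assumes sym: "\<And>i j. i < n \<Longrightarrow> j < n \<Longrightarrow> a i j = a j i" and "m \<le> n"
  shows "\<exists>\<theta> p. (\<forall>r<m. \<forall>s<m. (\<Sum>i<n. p r i * p s i) = of_bool (r = s)) \<and>
                (\<forall>r<m. \<forall>i<n. (\<Sum>j<n. a i j * p r j) = \<theta> r * p r i)"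
  using \<open>m \<le> n\<close>
proof (induction m)
  case 0
  then show ?case by simp
next
  case (Suc m)
  then obtain \<theta> p
    where on: "\<And>r s. r < m \<Longrightarrow> s < m \<Longrightarrow> (\<Sum>i<n. p r i * p s i) = of_bool (r = s)"
      and ev: "\<And>r i. r < m \<Longrightarrow> i < n \<Longrightarrow> (\<Sum>j<n. a i j * p r j) = \<theta> r * p r i"
    by (metis Suc_leD)
  \<comment> \<open>Without the summand 1 the deflated trace would be exactly
    \<open>n * \<kappa>\<close>; with it the trace is \<open>n * \<kappa> - (n - m)\<close>, which
    is smaller because \<open>m < n\<close>.\<close>
  define \<kappa> where "\<kappa> = ((\<Sum>i<n. a i i) - (\<Sum>r<m. \<theta> r)) / (real n - real m) + 1"
  define b where "b i j = a i j + (\<Sum>r<m. (\<kappa> - \<theta> r) * p r i * p r j)" for i j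
  have b_sym: "b i j = b j i" if "i < n" "j < n" for i j
    using sym[OF that] by (simp add: b_def mult_ac)
  have "(\<Sum>i<n. b i i) = (\<Sum>i<n. a i i) + (\<Sum>r<m. (\<kappa> - \<theta> r) * (\<Sum>i<n. p r i * p r i))"
    unfolding b_def sum.distrib sum_distrib_left by (subst (2) sum.swap) (simp add: mult.assoc)
  also have "\<dots> = (\<Sum>i<n. a i i) + (\<Sum>r<m. \<kappa> - \<theta> r)"
    by (simp add: on)
  also have "\<dots> = (\<Sum>i<n. a i i) - (\<Sum>r<m. \<theta> r) + real m * \<kappa>"
    by (simp add: sum_subtractf)
  also have "\<dots> \<noteq> real n * \<kappa>"
  proof -
    have "(real n - real m) * \<kappa> = (\<Sum>i<n. a i i) - (\<Sum>r<m. \<theta> r) + (real n - real m)"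
      using Suc.prems by (simp add: \<kappa>_def distrib_left)
    moreover have "real m < real n"
      using Suc.prems by simp
    ultimately show ?thesis
      by (simp add: left_diff_distrib)
  qed
  finally obtain l x where l: "l \<noteq> \<kappa>" and x0: "\<exists>i<n. x i \<noteq> 0"
    and bx: "\<And>i. i < n \<Longrightarrow> (\<Sum>j<n. b i j * x j) = l * x i"
    using symmetric_eigenvector_avoiding[of n b \<kappa>] b_sym by blast
  have bp: "(\<Sum>j<n. b i j * p s j) = \<kappa> * p s i" if "s < m" "i < n" for s i
  proof -
    have "(\<Sum>j<n. b i j * p s j)
        = (\<Sum>j<n. a i j * p s j) + (\<Sum>j<n. \<Sum>r<m. (\<kappa> - \<theta> r) * p r i * (p r j * p s j))"
      by (simp add: b_def algebra_simps sum.distrib sum_distrib_left sum_distrib_right)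
    also have "(\<Sum>j<n. \<Sum>r<m. (\<kappa> - \<theta> r) * p r i * (p r j * p s j))
        = (\<Sum>r<m. (\<kappa> - \<theta> r) * p r i * (\<Sum>j<n. p r j * p s j))"
      by (subst sum.swap) (simp add: sum_distrib_left)
    also have "\<dots> = (\<kappa> - \<theta> s) * p s i"
      using that by (simp add: on of_bool_def if_distrib cong: if_cong)
    finally show ?thesis using ev[OF that] by (simp add: algebra_simps)
  qed
  \<comment> \<open>Eigenvectors of the symmetric \<open>b\<close> for the distinct values
    \<open>l\<close> and \<open>\<kappa>\<close> are orthogonal.\<close>
  have orth: "(\<Sum>i<n. p s i * x i) = 0" if "s < m" for s
  proof -
    have "l * (\<Sum>i<n. p s i * x i) = (\<Sum>i<n. \<Sum>j<n. p s i * (b i j * x j))"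
      unfolding sum_distrib_left
      by (intro sum.cong refl) (simp add: sum_distrib_left[symmetric] bx)
    also have "\<dots> = (\<Sum>j<n. \<Sum>i<n. b j i * p s i * x j)"
      by (subst sum.swap) (intro sum.cong refl, simp add: b_sym mult_ac)
    also have "\<dots> = (\<Sum>j<n. (\<kappa> * p s j) * x j)"
      by (intro sum.cong refl) (simp add: sum_distrib_right[symmetric] bp that)
    also have "\<dots> = \<kappa> * (\<Sum>i<n. p s i * x i)"
      by (simp add: sum_distrib_left mult.assoc)
    finally show ?thesis using l by simp
  qed
  \<comment> \<open>The deflation term vanishes on \<open>x\<close>, so \<open>x\<close> is an
    eigenvector of the original \<open>a\<close> as well.\<close>
  have ax: "(\<Sum>j<n. a i j * x j) = l * x i" if "i < n" for i
  proof -
    have "(\<Sum>j<n. b i j * x j)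
        = (\<Sum>j<n. a i j * x j) + (\<Sum>j<n. \<Sum>r<m. (\<kappa> - \<theta> r) * p r i * (p r j * x j))"
      by (simp add: b_def algebra_simps sum.distrib sum_distrib_left sum_distrib_right)
    also have "(\<Sum>j<n. \<Sum>r<m. (\<kappa> - \<theta> r) * p r i * (p r j * x j))
        = (\<Sum>r<m. (\<kappa> - \<theta> r) * p r i * (\<Sum>j<n. p r j * x j))"
      by (subst sum.swap) (simp add: sum_distrib_left)
    also have "\<dots> = 0" by (simp add: orth)
    finally show ?thesis using bx[OF that] by simp
  qed
  define c where "c = sqrt (\<Sum>i<n. x i * x i)"
  have "(\<Sum>i<n. x i * x i) \<noteq> 0"
    using x0 by (subst sum_nonneg_eq_0_iff) auto
  moreover have "(\<Sum>i<n. x i * x i) \<ge> 0"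
    by (intro sum_nonneg) auto
  ultimately have c: "c * c = (\<Sum>i<n. x i * x i)" "c \<noteq> 0"
    by (simp_all add: c_def)
  define q where "q = p(m := \<lambda>i. x i / c)"
  have q: "q r = p r" if "r < m" for r using that by (simp add: q_def)
  have qm: "q m i = x i / c" for i by (simp add: q_def)
  have qq: "(\<Sum>i<n. q m i * q m i) = 1"
    using c(2) by (simp add: qm sum_divide_distrib[symmetric] c(1)[symmetric])
  have "(\<Sum>i<n. q r i * q m i) = 0" "(\<Sum>i<n. q m i * q r i) = 0" if "r < m" for r
    using orth[OF that] by (simp_all add: q that qm sum_divide_distrib[symmetric] mult.commute)
  then have "\<forall>r<Suc m. \<forall>s<Suc m. (\<Sum>i<n. q r i * q s i) = of_bool (r = s)"
    using on qq by (auto simp: less_Suc_eq q)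
  moreover have "\<forall>r<Suc m. \<forall>i<n. (\<Sum>j<n. a i j * q r j) = (\<theta>(m := l)) r * q r i"
    using ev ax by (auto simp: less_Suc_eq q qm sum_divide_distrib[symmetric])
  ultimately show ?case by blast
qed

text \<open>The second conclusion is the resolution of the identity: for the square matrix
  \<open>P\<close> with rows \<open>p r\<close>, a right inverse is also a left inverse.\<close>

theorem symmetric_spectral_decomposition:
  fixes a :: "nat \<Rightarrow> nat \<Rightarrow> real"
  assumes "\<And>i j. i < n \<Longrightarrow> j < n \<Longrightarrow> a i j = a j i"
  obtains p \<theta> where
    "\<And>r s. r < n \<Longrightarrow> s < n \<Longrightarrow> (\<Sum>i<n. p r i * p s i) = of_bool (r = s)"
    "\<And>i j. i < n \<Longrightarrow> j < n \<Longrightarrow> (\<Sum>r<n. p r i * p r j) = of_bool (i = j)"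
    "\<And>r i. r < n \<Longrightarrow> i < n \<Longrightarrow> (\<Sum>j<n. a i j * p r j) = \<theta> r * p r i"
proof -
  obtain \<theta> p
    where on: "\<And>r s. r < n \<Longrightarrow> s < n \<Longrightarrow> (\<Sum>i<n. p r i * p s i) = of_bool (r = s)"
      and ev: "\<And>r i. r < n \<Longrightarrow> i < n \<Longrightarrow> (\<Sum>j<n. a i j * p r j) = \<theta> r * p r i"
    using symmetric_orthonormal_eigenvectors[of n a n, OF assms order_refl] by blast
  define P where "P = mat n n (\<lambda>(r, i). p r i)"
  have P: "P \<in> carrier_mat n n" by (simp add: P_def)
  have "P * P\<^sup>T = 1\<^sub>m n"
    by (rule eq_matI) (auto simp: P_def scalar_prod_def lessThan_atLeast0[symmetric] on)
  then have PT: "P\<^sup>T * P = 1\<^sub>m n"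
    using P by (intro mat_mult_left_right_inverse[of P n]) auto
  have "(\<Sum>r<n. p r i * p r j) = of_bool (i = j)" if "i < n" "j < n" for i j
  proof -
    have "(P\<^sup>T * P) $$ (i, j) = (\<Sum>r<n. p r i * p r j)"
      using that by (auto simp: P_def scalar_prod_def lessThan_atLeast0[symmetric])
    then show ?thesis using PT that by (cases "i = j") auto
  qed
  then show thesis using that on ev by blast
qed

subsection \<open>Real numbers on a common grid\<close>

text \<open>The differences \<open>M - x\<close> are distinct positive integers, so their squares
  sum to at least 1^2 + ... + k^2 with k = \<open>card K\<close>. A new minimum \<open>b\<close>
  satisfies \<open>M - b\<close> \<ge> k + 1, since k + 1 integers fit into
  \<open>{b..<M}\<close>.\<close>

lemma sum_squares_to_upper_bound_ge:
  fixes K :: "int set"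
  assumes "finite K" "\<And>x. x \<in> K \<Longrightarrow> x < M"
  shows "int (card K) * (int (card K) + 1) * (2 * int (card K) + 1) \<le> 6 * (\<Sum>x\<in>K. (M - x)\<^sup>2)"
  using assms
proof (induction K rule: finite_linorder_min_induct)
  case empty
  then show ?case by simp
next
  case (insert b K)
  have b: "b \<notin> K" using insert.hyps(2) by blast
  have "insert b K \<subseteq> {b..<M}" using insert.hyps(2) insert.prems by force
  then have "card (insert b K) \<le> card {b..<M}"
    by (intro card_mono) auto
  then have "int (card K) + 1 \<le> M - b"
    using b insert.hyps(1) insert.prems[of b] by simp
  then have "(int (card K) + 1)\<^sup>2 \<le> (M - b)\<^sup>2"
    by (intro power_mono) auto
  then have "6 * (int (card K) + 1)\<^sup>2 + int (card K) * (int (card K) + 1) * (2 * int (card K) + 1)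
      \<le> 6 * (\<Sum>x\<in>insert b K. (M - x)\<^sup>2)"
    using insert.IH insert.prems insert.hyps(1) b by simp
  then show ?case
    using b insert.hyps(1) by (simp add: algebra_simps power2_eq_square)
qed

text \<open>Consecutive integers attain equality. A new maximum \<open>b\<close> contributes twice
  the sum of \<open>(b - x)\<^sup>2\<close>, which the preceding lemma bounds with
  \<open>M = b\<close>.\<close>

lemma sum_squares_differences_ge:
  fixes K :: "int set"
  assumes "finite K"
  shows "(int (card K))\<^sup>2 * ((int (card K))\<^sup>2 - 1) \<le> 6 * (\<Sum>x\<in>K. \<Sum>y\<in>K. (x - y)\<^sup>2)"
  using assms
proof (induction K rule: finite_linorder_max_induct)
  case empty
  then show ?case by simp
next
  case (insert b K)
  have b: "b \<notin> K" using insert.hyps(2) by blast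
  have "(\<Sum>x\<in>K. (x - b)\<^sup>2) = (\<Sum>x\<in>K. (b - x)\<^sup>2)"
    by (simp add: power2_commute)
  then have "(\<Sum>x\<in>insert b K. \<Sum>y\<in>insert b K. (x - y)\<^sup>2)
      = (\<Sum>x\<in>K. \<Sum>y\<in>K. (x - y)\<^sup>2) + 2 * (\<Sum>x\<in>K. (b - x)\<^sup>2)"
    using b insert.hyps(1) by (simp add: sum.distrib)
  then show ?case
    using insert.IH sum_squares_to_upper_bound_ge[of K b] insert.hyps b
    by (simp add: algebra_simps power2_eq_square)
qed

text \<open>Each squaring multiplies \<open>x ^ (2 ^ j) - 1\<close> by the even number
  \<open>x ^ (2 ^ j) + 1\<close>.\<close>

lemma odd_power_two_power:
  fixes x :: int
  assumes "odd x"
  shows "2 ^ j dvd x ^ (2 ^ j) - 1"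
proof (induction j)
  case 0
  then show ?case by simp
next
  case (Suc j)
  have "x ^ (2 ^ Suc j) - 1 = (x ^ (2 ^ j) - 1) * (x ^ (2 ^ j) + 1)"
    by (simp add: algebra_simps power_mult power2_eq_square)
  moreover have "2 dvd x ^ (2 ^ j) + 1" using assms by simp
  ultimately have "2 ^ j * 2 dvd x ^ (2 ^ Suc j) - 1"
    using mult_dvd_mono[OF Suc] by metis
  then show ?case by (simp add: mult.commute)
qed

text \<open>
  Lagrange interpolation makes the weights rational, say with common denominator \<open>D\<close>.
  The moment of order \<open>2\<^sup>j\<close>, multiplied by \<open>D\<close>, is then congruent to \<open>D/2\<close> modulo \<open>2\<^sup>j\<close>.
\<close>
lemma no_half_odd_weight:
  fixes w :: "nat \<Rightarrow> real" and \<mu> :: "nat \<Rightarrow> int"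
  assumes inj: "inj_on \<mu> {..<n}"
    and moments: "\<And>k. (\<Sum>r<n. w r * of_int (\<mu> r) ^ k) \<in> \<int>"
    and total: "(\<Sum>r<n. w r) = 1"
    and half: "(\<Sum>r | r < n \<and> odd (\<mu> r). w r) = 1 / 2"
  shows False
proof -
  have poly_moments: "(\<Sum>r<n. w r * of_int (poly f (\<mu> r))) \<in> \<int>" for f :: "int poly"
  proof -
    have "(\<Sum>r<n. w r * of_int (poly f (\<mu> r)))
        = (\<Sum>r<n. \<Sum>i\<le>degree f. of_int (coeff f i) * (w r * of_int (\<mu> r) ^ i))"
      by (simp add: poly_altdef sum_distrib_left mult_ac)
    also have "\<dots> = (\<Sum>i\<le>degree f. \<Sum>r<n. of_int (coeff f i) * (w r * of_int (\<mu> r) ^ i))"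
      by (rule sum.swap)
    also have "\<dots> = (\<Sum>i\<le>degree f. of_int (coeff f i) * (\<Sum>r<n. w r * of_int (\<mu> r) ^ i))"
      by (simp add: sum_distrib_left)
    also have "\<dots> \<in> \<int>"
      by (rule Ints_sum, rule Ints_mult[OF Ints_of_int moments])
    finally show ?thesis .
  qed
  define c where "c r = (\<Prod>s\<in>{..<n} - {r}. \<mu> r - \<mu> s)" for r
  have c0: "c r \<noteq> 0" if "r < n" for r
    using inj that by (auto simp: c_def inj_on_def)
  have cw: "of_int (c r) * w r \<in> \<int>" if "r < n" for r
  proof -
    \<comment> \<open>The unnormalised Lagrange polynomial at \<open>\<mu> r\<close>: it vanishes at
      all other nodes, so its moment isolates \<open>c r * w r\<close>.\<close>
    define f where "f = (\<Prod>s\<in>{..<n} - {r}. [:- \<mu> s, 1:])"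
    have "poly f (\<mu> t) = 0" if "t < n" "t \<noteq> r" for t
      using that by (auto simp: f_def poly_prod)
    moreover have "poly f (\<mu> r) = c r"
      by (simp add: f_def c_def poly_prod)
    ultimately have "(\<Sum>t<n. w t * of_int (poly f (\<mu> t))) = (\<Sum>t<n. if t = r then w r * of_int (c r) else 0)"
      by (intro sum.cong) auto
    then show ?thesis using poly_moments[of f] that by (simp add: mult.commute)
  qed
  define D where "D = \<bar>\<Prod>r<n. c r\<bar>"
  have D: "D > 0" using c0 by (simp add: D_def)
  have "of_int D * w r \<in> \<int>" if "r < n" for r
  proof -
    have "c r dvd D" using that by (simp add: D_def dvd_prodI)
    then obtain e where "D = c r * e" by blast
    then have "of_int D * w r = of_int e * (of_int (c r) * w r)" by simp
    then show ?thesis using cw[OF that] by (metis Ints_mult Ints_of_int)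
  qed
  then have "\<forall>r<n. \<exists>z. of_int D * w r = of_int z" by (auto elim: Ints_cases)
  then obtain W where W: "\<And>r. r < n \<Longrightarrow> of_int D * w r = of_int (W r)" by metis
  define h where "h = (\<Sum>r | r < n \<and> odd (\<mu> r). W r)"
  have "real_of_int h = of_int D * (\<Sum>r | r < n \<and> odd (\<mu> r). w r)"
    by (simp add: h_def sum_distrib_left W)
  then have "real_of_int (2 * h) = of_int D" by (simp add: half)
  then have Dh: "D = 2 * h" by linarith
  \<comment> \<open>The modulus is chosen so that \<open>h < 2 ^ j\<close>; divisibility of the
    positive \<open>h\<close> by \<open>2 ^ j\<close> is then absurd. The exponent \<open>K\<close>
    turns odd bases into 1 and, as \<open>K\<close> \<ge> \<open>j\<close>, even bases into 0 modulo
    \<open>2 ^ j\<close>.\<close>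
  define j where "j = nat h"
  define K where "K = (2::nat) ^ j"
  obtain L where L: "(\<Sum>r<n. w r * of_int (\<mu> r) ^ K) = of_int L"
    using moments[of K] by (auto elim: Ints_cases)
  have "real_of_int (\<Sum>r<n. W r * \<mu> r ^ K) = (\<Sum>r<n. of_int D * (w r * of_int (\<mu> r) ^ K))"
    unfolding of_int_sum by (intro sum.cong refl) (simp add: W[symmetric] mult.assoc)
  also have "\<dots> = of_int (D * L)"
    by (simp only: sum_distrib_left[symmetric] L of_int_mult)
  finally have DL: "(\<Sum>r<n. W r * \<mu> r ^ K) = D * L"
    by (simp only: of_int_eq_iff)
  have h_sum: "h = (\<Sum>r<n. if odd (\<mu> r) then W r else 0)"
    by (simp add: h_def sum.inter_filter[symmetric] lessThan_def)
  have "D * L - h = (\<Sum>r<n. W r * \<mu> r ^ K - (if odd (\<mu> r) then W r else 0))"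
    by (simp only: DL[symmetric] h_sum sum_subtractf)
  also have "\<dots> = (\<Sum>r<n. W r * (\<mu> r ^ K - of_bool (odd (\<mu> r))))"
    by (intro sum.cong refl) (simp add: right_diff_distrib)
  finally have "D * L - h = (\<Sum>r<n. W r * (\<mu> r ^ K - of_bool (odd (\<mu> r))))" .
  moreover have "2 ^ j dvd \<mu> r ^ K - of_bool (odd (\<mu> r))" for r
  proof (cases "odd (\<mu> r)")
    case True
    then show ?thesis using odd_power_two_power by (simp add: K_def)
  next
    case False
    then have "2 ^ K dvd \<mu> r ^ K" by (simp add: dvd_power_same)
    moreover have "(2::int) ^ j dvd 2 ^ K" by (simp add: K_def le_imp_power_dvd)
    ultimately show ?thesis using False by (auto intro: dvd_trans)
  qed
  ultimately have "2 ^ j dvd D * L - h"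
    by (simp only:) (intro dvd_sum dvd_mult)
  \<comment> \<open>The factor \<open>2 * L - 1\<close> is odd, hence coprime to
    \<open>2 ^ j\<close>.\<close>
  also have "D * L - h = h * (2 * L - 1)" by (simp add: Dh algebra_simps)
  finally have "2 ^ j dvd h"
    by (simp add: coprime_dvd_mult_left_iff)
  then have "2 ^ j \<le> h" using D Dh by (intro zdvd_imp_le) auto
  moreover have "h < 2 ^ j"
    using D Dh of_nat_less_two_power[of j, where ?'a = int] by (simp add: j_def)
  ultimately show False by simp
qed

section \<open>Integrality and size of the squared grid step\<close>

text \<open>Up to sign \<open>x\<close> is the square root of an integer, hence an algebraic
  integer, and rational algebraic integers are integers.\<close>

lemma Ints_if_square_Ints:
  fixes x :: real
  assumes "x \<in> \<rat>" "x\<^sup>2 \<in> \<int>"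
  shows "x \<in> \<int>"
proof (rule rational_algebraic_int_is_int)
  have "algebraic_int (sqrt (x\<^sup>2))"
    using assms(2) by (intro algebraic_int_sqrt int_imp_algebraic_int)
  then show "algebraic_int x" by simp
qed (use assms in auto)

text \<open>Zero trace forces \<open>\<theta> 0\<close> to be \<open>- g\<close> times the mean of
  the \<open>k r\<close>; so \<open>q r\<close> is \<open>k r\<close> minus that mean.\<close>

lemma grid_rational:
  fixes \<theta> :: "nat \<Rightarrow> real" and k :: "nat \<Rightarrow> int"
  assumes grid: "\<And>r. r < n \<Longrightarrow> \<theta> r = \<theta> 0 + g * of_int (k r)"
    and trace: "(\<Sum>r<n. \<theta> r) = 0" and "n > 0"
  shows "\<exists>q. (\<forall>r<n. q r \<in> \<rat> \<and> \<theta> r = g * q r \<and> (\<forall>s<n. q r - q s = of_int (k r - k s)))"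
proof -
  have "(\<Sum>r<n. \<theta> r) = real n * \<theta> 0 + g * (\<Sum>r<n. of_int (k r))"
    by (subst sum.cong[OF refl grid]) (auto simp: sum.distrib sum_distrib_left)
  then have \<theta>0: "\<theta> 0 = - g * (\<Sum>r<n. of_int (k r)) / real n"
    using trace \<open>n > 0\<close> by (simp add: field_simps)
  define q where "q r = of_int (k r) - (\<Sum>r<n. of_int (k r)) / real n" for r
  have "q r \<in> \<rat>" for r
    unfolding q_def by (intro Rats_diff Rats_divide Rats_sum) auto
  moreover have "\<theta> r = g * q r" if "r < n" for r
    using grid[OF that] \<theta>0 by (simp add: q_def algebra_simps)
  moreover have "q r - q s = of_int (k r - k s)" for r s
    by (simp add: q_def)
  ultimately show ?thesis by blast
qed

text \<open>Dividing the sum of the squared eigenvalues by that of the \<open>(q r)\<^sup>2\<close>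
  shows \<open>g\<^sup>2\<close> to be rational. Its denominator divides every
  \<open>(k r)\<^sup>2\<close>, because \<open>g\<^sup>2 * (k r)\<^sup>2\<close> is the integer
  \<open>(\<theta> r - \<theta> 0)\<^sup>2\<close>, and the gcd condition reduces it to 1.\<close>

lemma grid_square_Ints:
  fixes \<theta> :: "nat \<Rightarrow> real" and k :: "nat \<Rightarrow> int"
  assumes grid: "\<And>r. r < n \<Longrightarrow> \<theta> r = \<theta> 0 + g * of_int (k r)"
    and Gcd: "Gcd (k ` {..<n}) = 1" and k0: "k 0 = 0"
    and trace: "(\<Sum>r<n. \<theta> r) = 0" and "n > 0"
    and squares: "(\<Sum>r<n. (\<theta> r)\<^sup>2) \<in> \<rat>"
    and alg: "\<And>r. r < n \<Longrightarrow> algebraic_int ((\<theta> r)\<^sup>2)"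
  shows "g\<^sup>2 \<in> \<int>" "\<And>r. r < n \<Longrightarrow> (\<theta> r)\<^sup>2 \<in> \<int>"
proof -
  obtain q where q: "\<And>r. r < n \<Longrightarrow> q r \<in> \<rat>" "\<And>r. r < n \<Longrightarrow> \<theta> r = g * q r"
    and qk: "\<And>r s. r < n \<Longrightarrow> s < n \<Longrightarrow> q r - q s = of_int (k r - k s)"
    using grid_rational[OF grid trace \<open>n > 0\<close>] by blast
  have "\<exists>r<n. k r \<noteq> 0"
    using Gcd by (metis (mono_tags, lifting) Gcd_0_iff image_subset_iff insertI1 lessThan_iff zero_neq_one)
  then have "\<exists>r<n. q r \<noteq> 0"
    using qk k0 \<open>n > 0\<close> by (metis diff_0_right diff_self of_int_eq_0_iff)
  then have "(\<Sum>r<n. (q r)\<^sup>2) \<noteq> 0"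
    by (subst sum_nonneg_eq_0_iff) auto
  moreover have "(\<Sum>r<n. (\<theta> r)\<^sup>2) = g\<^sup>2 * (\<Sum>r<n. (q r)\<^sup>2)"
    by (simp add: q sum_distrib_left power_mult_distrib)
  ultimately have "g\<^sup>2 = (\<Sum>r<n. (\<theta> r)\<^sup>2) / (\<Sum>r<n. (q r)\<^sup>2)"
    by simp
  then have g: "g\<^sup>2 \<in> \<rat>"
    using squares q(1) by (auto intro!: Rats_divide Rats_sum Rats_power)
  show sq: "(\<theta> r)\<^sup>2 \<in> \<int>" if "r < n" for r
    using alg[OF that] g q that
    by (intro rational_algebraic_int_is_int) (auto simp: power_mult_distrib intro!: Rats_mult Rats_power)
  have kk: "g\<^sup>2 * (of_int (k r))\<^sup>2 \<in> \<int>" if "r < n" for r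
  proof -
    \<comment> \<open>The cross term involves \<open>g\<close> only through its square, so it is
      rational even when \<open>g\<close> is not.\<close>
    have "\<theta> r * \<theta> 0 = g\<^sup>2 * q r * q 0"
      using that \<open>n > 0\<close> by (simp add: q power2_eq_square)
    then have "\<theta> r * \<theta> 0 \<in> \<rat>"
      using g q(1) that \<open>n > 0\<close> by (auto intro!: Rats_mult)
    moreover have "(\<theta> r * \<theta> 0)\<^sup>2 \<in> \<int>"
      using sq that \<open>n > 0\<close> by (auto simp: power_mult_distrib intro!: Ints_mult)
    ultimately have "\<theta> r * \<theta> 0 \<in> \<int>" by (rule Ints_if_square_Ints)
    moreover have "g\<^sup>2 * (of_int (k r))\<^sup>2 = (\<theta> r)\<^sup>2 + (\<theta> 0)\<^sup>2 - 2 * (\<theta> r * \<theta> 0)"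
      by (subst (1 2) grid[OF that]) (simp add: power2_eq_square algebra_simps)
    ultimately show ?thesis
      using sq that \<open>n > 0\<close> by (auto intro!: Ints_diff Ints_add Ints_mult)
  qed
  obtain a b :: int where ab: "b > 0" "coprime a b" "g\<^sup>2 = of_int a / of_int b"
    using g by (auto elim: Rats_cases')
  have bk: "b dvd (k r)\<^sup>2" if r: "r < n" for r
  proof -
    obtain z where "g\<^sup>2 * (of_int (k r))\<^sup>2 = of_int z"
      using kk[OF r] by (auto elim: Ints_cases)
    then have "real_of_int (a * (k r)\<^sup>2) = of_int (b * z)"
      using ab by (simp add: field_simps)
    then have "a * (k r)\<^sup>2 = b * z" by (metis of_int_eq_iff)
    then have "b dvd a * (k r)\<^sup>2" by simp
    then show ?thesis
      using ab(2) by (simp add: coprime_dvd_mult_right_iff coprime_commute)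
  qed
  have "is_unit b"
  proof (rule ccontr)
    assume "\<not> is_unit b"
    then obtain p where p: "prime p" "p dvd b"
      using ab(1) by (metis less_irrefl prime_divisorE)
    then have "p dvd k r" if "r < n" for r
      using bk that by (meson dvd_trans prime_dvd_power)
    then have "p dvd Gcd (k ` {..<n})" by (auto intro: Gcd_greatest)
    then show False using p Gcd by auto
  qed
  then have "b = 1" using ab(1) by simp
  then show "g\<^sup>2 \<in> \<int>" using ab by simp
qed

text \<open>By zero trace, the squares of all differences \<open>\<theta> r - \<theta> s\<close> sum
  to \<open>2 * n\<close> times the sum of the \<open>(\<theta> r)\<^sup>2\<close>; the spread of
  distinct integers bounds the same double sum from below.\<close>

lemma grid_square_bound:
  fixes \<theta> :: "nat \<Rightarrow> real" and k :: "nat \<Rightarrow> int"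
  assumes grid: "\<And>r. r < n \<Longrightarrow> \<theta> r = \<theta> 0 + g * of_int (k r)"
    and inj: "inj_on k {..<n}" and trace: "(\<Sum>r<n. \<theta> r) = 0"
  shows "g\<^sup>2 * ((real n)\<^sup>2 * ((real n)\<^sup>2 - 1)) \<le> 12 * real n * (\<Sum>r<n. (\<theta> r)\<^sup>2)"
proof -
  have "(\<Sum>x\<in>k ` {..<n}. \<Sum>y\<in>k ` {..<n}. (x - y)\<^sup>2) = (\<Sum>r<n. \<Sum>s<n. (k r - k s)\<^sup>2)"
    using inj by (simp add: sum.reindex)
  then have "(int n)\<^sup>2 * ((int n)\<^sup>2 - 1) \<le> 6 * (\<Sum>r<n. \<Sum>s<n. (k r - k s)\<^sup>2)"
    using sum_squares_differences_ge[of "k ` {..<n}"] inj by (simp add: card_image)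
  then have "real_of_int ((int n)\<^sup>2 * ((int n)\<^sup>2 - 1)) \<le> of_int (6 * (\<Sum>r<n. \<Sum>s<n. (k r - k s)\<^sup>2))"
    by (simp only: of_int_le_iff)
  then have "(real n)\<^sup>2 * ((real n)\<^sup>2 - 1) \<le> 6 * (\<Sum>r<n. \<Sum>s<n. (real_of_int (k r) - of_int (k s))\<^sup>2)"
    by simp
  then have "g\<^sup>2 * ((real n)\<^sup>2 * ((real n)\<^sup>2 - 1))
      \<le> g\<^sup>2 * (6 * (\<Sum>r<n. \<Sum>s<n. (real_of_int (k r) - of_int (k s))\<^sup>2))"
    by (intro mult_left_mono) auto
  also have "\<dots> = 6 * (\<Sum>r<n. \<Sum>s<n. (g * (real_of_int (k r) - of_int (k s)))\<^sup>2)"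
    by (simp add: sum_distrib_left power_mult_distrib mult_ac)
  also have "\<dots> = 6 * (\<Sum>r<n. \<Sum>s<n. (\<theta> r - \<theta> s)\<^sup>2)"
    using grid by (intro arg_cong[of _ _ "\<lambda>x. 6 * x"] sum.cong refl arg_cong[of _ _ "\<lambda>x. x\<^sup>2"])
      (smt (verit) lessThan_iff right_diff_distrib)
  also have "(\<Sum>r<n. \<Sum>s<n. (\<theta> r - \<theta> s)\<^sup>2)
      = (\<Sum>r<n. \<Sum>s<n. (\<theta> r)\<^sup>2) + (\<Sum>r<n. \<Sum>s<n. (\<theta> s)\<^sup>2) - 2 * (\<Sum>r<n. \<Sum>s<n. \<theta> r * \<theta> s)"
    by (simp add: power2_diff sum.distrib sum_subtractf sum_distrib_left mult.assoc)
  also have "\<dots> = 2 * real n * (\<Sum>r<n. (\<theta> r)\<^sup>2)"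
    using trace by (simp add: sum_distrib_left[symmetric])
  finally show ?thesis by simp
qed

subsection \<open>Phases and matrix powers\<close>

text \<open>
  The equality case of Cauchy--Schwarz, read off from
  \<open>a\<^sup>2 + b\<^sup>2 - 2 x a b = (a - x b)\<^sup>2 + (1 - x\<^sup>2) b\<^sup>2\<close> with \<open>x = Re (cnj \<gamma> * c)\<close>.
\<close>
lemma unit_phases_aligned:
  fixes c :: "nat \<Rightarrow> complex" and a b :: "nat \<Rightarrow> real"
  assumes c: "\<And>r. r < n \<Longrightarrow> cmod (c r) = 1"
    and a: "(\<Sum>r<n. (a r)\<^sup>2) = 1" and b: "(\<Sum>r<n. (b r)\<^sup>2) = 1"
    and a0: "\<And>r. r < n \<Longrightarrow> a r \<noteq> 0"
    and unit: "cmod (\<Sum>r<n. c r * of_real (a r) * of_real (b r)) = 1"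
  shows "\<exists>\<gamma> d. \<forall>r<n. (d r = 1 \<or> d r = -1) \<and> b r = d r * a r \<and> c r = \<gamma> * of_real (d r)"
proof -
  define \<gamma> where "\<gamma> = (\<Sum>r<n. c r * of_real (a r) * of_real (b r))"
  have \<gamma>: "cmod \<gamma> = 1" using unit by (simp add: \<gamma>_def)
  have \<gamma>1: "\<gamma> * cnj \<gamma> = 1" using \<gamma> by (simp add: complex_norm_square[symmetric])
  define d where "d r = Re (cnj \<gamma> * c r)" for r
  have norm1: "cmod (cnj \<gamma> * c r) = 1" if "r < n" for r
    using c[OF that] \<gamma> by (simp add: norm_mult)
  have d1: "(d r)\<^sup>2 \<le> 1" if "r < n" for r
    using abs_Re_le_cmod[of "cnj \<gamma> * c r"] norm1[OF that] by (simp add: d_def abs_square_le_1)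
  have "1 = Re (cnj \<gamma> * \<gamma>)" using \<gamma>1 by (simp add: mult.commute)
  also have "\<dots> = (\<Sum>r<n. Re ((cnj \<gamma> * c r) * of_real (a r * b r)))"
    by (subst (2) \<gamma>_def) (simp add: sum_distrib_left mult.assoc)
  also have "\<dots> = (\<Sum>r<n. d r * (a r * b r))"
    unfolding d_def by (intro sum.cong refl) (subst Re_complex_of_real[symmetric], simp del: Re_complex_of_real)
  finally have dab: "(\<Sum>r<n. d r * (a r * b r)) = 1" by simp
  have "(\<Sum>r<n. (a r - d r * b r)\<^sup>2 + (1 - (d r)\<^sup>2) * (b r)\<^sup>2)
      = (\<Sum>r<n. (a r)\<^sup>2 + (b r)\<^sup>2 - 2 * (d r * (a r * b r)))"
    by (intro sum.cong refl) (simp add: power2_eq_square algebra_simps)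
  also have "\<dots> = 0"
    using a b dab by (simp add: sum.distrib sum_subtractf flip: sum_distrib_left)
  finally have "(\<Sum>r<n. (a r - d r * b r)\<^sup>2 + (1 - (d r)\<^sup>2) * (b r)\<^sup>2) = 0" .
  then have eq: "(a r - d r * b r)\<^sup>2 + (1 - (d r)\<^sup>2) * (b r)\<^sup>2 = 0" if "r < n" for r
    using that d1 by (subst (asm) sum_nonneg_eq_0_iff) auto
  have a_eq: "a r = d r * b r" and d_sq: "(d r)\<^sup>2 = 1" if r: "r < n" for r
  proof -
    have "(a r - d r * b r)\<^sup>2 = 0" "(1 - (d r)\<^sup>2) * (b r)\<^sup>2 = 0"
      using eq[OF r] d1[OF r] by (auto simp: add_nonneg_eq_0_iff)
    then show "a r = d r * b r" "(d r)\<^sup>2 = 1"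
      using a0[OF r] by auto
  qed
  have "d r = 1 \<or> d r = -1" if "r < n" for r
    using d_sq[OF that] by (simp add: power2_eq_1_iff)
  moreover have "b r = d r * a r" if "r < n" for r
  proof -
    have "d r * a r = (d r)\<^sup>2 * b r" using a_eq[OF that] by (simp add: power2_eq_square)
    then show ?thesis using d_sq[OF that] by simp
  qed
  moreover have "c r = \<gamma> * of_real (d r)" if "r < n" for r
  proof -
    have "(Re (cnj \<gamma> * c r))\<^sup>2 + (Im (cnj \<gamma> * c r))\<^sup>2 = 1"
      using norm1[OF that] cmod_power2[of "cnj \<gamma> * c r"] by simp
    then have "Im (cnj \<gamma> * c r) = 0" using d_sq[OF that] by (simp add: d_def)
    then have "cnj \<gamma> * c r = of_real (d r)" unfolding d_def by (simp add: complex_eq_iff)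
    then have "\<gamma> * (cnj \<gamma> * c r) = \<gamma> * of_real (d r)" by simp
    then show ?thesis using \<gamma>1 by (simp add: mult.assoc[symmetric])
  qed
  ultimately show ?thesis by blast
qed

text \<open>Relative to index 0 all phases are 1 or -1, so
  \<open>\<tau> * (\<theta> r - \<theta> 0)\<close> is an integer multiple \<open>l r\<close> of pi
  whose parity records the sign. Dividing the \<open>l r\<close> by their gcd \<open>D\<close>
  preserves parities because \<open>D\<close> is odd.\<close>

lemma phases_on_grid:
  fixes \<theta> a d :: "nat \<Rightarrow> real"
  assumes phase: "\<And>r. r < n \<Longrightarrow> cis (\<tau> * \<theta> r) = \<gamma> * of_real (d r)"
    and d: "\<And>r. r < n \<Longrightarrow> d r = 1 \<or> d r = -1"
    and total: "(\<Sum>r<n. (a r)\<^sup>2) = 1" and orth: "(\<Sum>r<n. d r * (a r)\<^sup>2) = 0" and "n > 0"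
  obtains g k where "\<And>r. r < n \<Longrightarrow> \<theta> r = \<theta> 0 + g * of_int (k r)"
    "Gcd (k ` {..<n}) = 1" "k 0 = 0" "(\<Sum>r | r < n \<and> odd (k r). (a r)\<^sup>2) = 1 / 2"
proof -
  have cis_diff: "cis (\<tau> * \<theta> r - \<tau> * \<theta> 0) = of_real (d r * d 0)" if "r < n" for r
  proof -
    have "\<gamma> \<noteq> 0" using phase[OF that] by (metis cis_neq_zero mult_zero_left)
    then have "cis (\<tau> * \<theta> r - \<tau> * \<theta> 0) = of_real (d r) / of_real (d 0)"
      using phase[OF that] phase[OF \<open>n > 0\<close>] by (simp flip: cis_divide)
    then show ?thesis using d[OF \<open>n > 0\<close>] by auto
  qed
  have "\<exists>l::int. \<tau> * \<theta> r - \<tau> * \<theta> 0 = of_int l * pi" if "r < n" for r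
    using arg_cong[OF cis_diff[OF that], of Im] by (simp flip: sin_zero_iff_int2)
  then obtain l :: "nat \<Rightarrow> int"
    where l: "\<And>r. r < n \<Longrightarrow> \<tau> * \<theta> r - \<tau> * \<theta> 0 = of_int (l r) * pi" by metis
  have l_sign: "d r * d 0 = (if odd (l r) then -1 else 1)" if "r < n" for r
  proof -
    have "cos (pi * of_int (l r)) = d r * d 0"
      using arg_cong[OF cis_diff[OF that], of Re]
      by (simp add: l[OF that] mult.commute[of _ pi] del: cos_npi_int)
    then show ?thesis by (cases "odd (l r)") auto
  qed
  \<comment> \<open>The sign \<open>d 0 * d r\<close> is 1 minus twice the indicator of odd
    \<open>l r\<close>, so orthogonality splits the total weight evenly.\<close>
  let ?odd_part = "\<lambda>r. if odd (l r) then (a r)\<^sup>2 else 0"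
  have "(\<Sum>r<n. (a r)\<^sup>2) - 2 * (\<Sum>r<n. ?odd_part r) = (\<Sum>r<n. (a r)\<^sup>2 - 2 * ?odd_part r)"
    by (simp only: sum_subtractf sum_distrib_left)
  also have "\<dots> = (\<Sum>r<n. d 0 * (d r * (a r)\<^sup>2))"
  proof (intro sum.cong refl)
    fix r assume "r \<in> {..<n}"
    then have "d 0 * d r = (if odd (l r) then -1 else 1)"
      using l_sign[of r] by (simp add: mult.commute)
    then show "(a r)\<^sup>2 - 2 * ?odd_part r = d 0 * (d r * (a r)\<^sup>2)"
      by (simp add: mult.assoc[symmetric])
  qed
  also have "\<dots> = 0"
    using orth by (simp flip: sum_distrib_left)
  finally have "(\<Sum>r<n. ?odd_part r) = 1 / 2"
    using total by simp
  moreover have "(\<Sum>r<n. ?odd_part r) = (\<Sum>r | r < n \<and> odd (l r). (a r)\<^sup>2)"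
    by (simp add: sum.inter_filter[symmetric] lessThan_def)
  ultimately have half: "(\<Sum>r | r < n \<and> odd (l r). (a r)\<^sup>2) = 1 / 2"
    by simp
  \<comment> \<open>An odd \<open>l r\<close> excludes \<open>\<tau> = 0\<close> and makes the gcd
    odd.\<close>
  have "\<exists>r<n. odd (l r)"
  proof (rule ccontr)
    assume "\<not> ?thesis"
    then have "{r. r < n \<and> odd (l r)} = {}" by blast
    then have "(\<Sum>r | r < n \<and> odd (l r). (a r)\<^sup>2) = 0" by (simp only: sum.empty)
    then show False using half by simp
  qed
  then obtain r1 where r1: "r1 < n" "odd (l r1)" by blast
  then have \<tau>: "\<tau> \<noteq> 0" using l[OF r1(1)] by auto
  define D where "D = Gcd (l ` {..<n})"
  have Dl: "D dvd l r" if "r < n" for r using that by (auto simp: D_def)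
  have "odd D" using Dl[OF r1(1)] r1(2) by (meson dvd_trans)
  then have D0: "D \<noteq> 0" by auto
  define k where "k r = l r div D" for r
  have lk: "l r = D * k r" if "r < n" for r using Dl[OF that] by (simp add: k_def)
  have "l ` {..<n} = (*) D ` k ` {..<n}" unfolding image_image using lk by (intro image_cong) auto
  then have "Gcd (l ` {..<n}) = normalize (D * Gcd (k ` {..<n}))"
    by (simp only: Gcd_mult)
  moreover have "D \<ge> 0" by (simp add: D_def)
  ultimately have "D = D * Gcd (k ` {..<n})"
    by (simp add: D_def[symmetric] abs_mult)
  then have gcd1: "Gcd (k ` {..<n}) = 1" using D0 by simp
  have grid: "\<theta> r = \<theta> 0 + (pi * of_int D / \<tau>) * of_int (k r)" if "r < n" for r
  proof -
    have "\<tau> * (\<theta> r - \<theta> 0) = of_int D * of_int (k r) * pi"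
      using l[OF that] lk[OF that] by (simp add: right_diff_distrib)
    then show ?thesis using \<tau> by (simp add: field_simps)
  qed
  have k0: "k 0 = 0" using l[OF \<open>n > 0\<close>] by (simp add: k_def)
  have "{r. r < n \<and> odd (l r)} = {r. r < n \<and> odd (k r)}"
    using lk \<open>odd D\<close> by auto
  then have "(\<Sum>r | r < n \<and> odd (k r). (a r)\<^sup>2) = 1 / 2" using half by simp
  then show thesis using that grid gcd1 k0 by blast
qed

section \<open>Matrix powers, exponentials and integrality\<close>

text \<open>Generality over commutative rings serves both real integer matrices and the complex
  matrix inside the exponential. Completeness is the case of exponent 0.\<close>

lemma pow_mat_spectral:
  fixes M :: "'a :: comm_ring_1 mat"
  assumes M: "M \<in> carrier_mat n n"
    and complete: "\<And>i j. i < n \<Longrightarrow> j < n \<Longrightarrow> (\<Sum>r<n. p r i * p r j) = of_bool (i = j)"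
    and ev: "\<And>r j. r < n \<Longrightarrow> j < n \<Longrightarrow> (\<Sum>i<n. p r i * M $$ (i, j)) = \<theta> r * p r j"
    and "i < n" "j < n"
  shows "(M ^\<^sub>m k) $$ (i, j) = (\<Sum>r<n. \<theta> r ^ k * p r i * p r j)"
  using \<open>j < n\<close>
proof (induction k arbitrary: j)
  case 0
  then show ?case using M \<open>i < n\<close> complete[of i j] by simp
next
  case (Suc k)
  have "(M ^\<^sub>m Suc k) $$ (i, j) = (\<Sum>l<n. (M ^\<^sub>m k) $$ (i, l) * M $$ (l, j))"
    using M pow_carrier_mat[OF M, of k] \<open>i < n\<close> Suc.prems
    by (simp add: scalar_prod_def lessThan_atLeast0)
  also have "\<dots> = (\<Sum>l<n. \<Sum>r<n. \<theta> r ^ k * p r i * (p r l * M $$ (l, j)))"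
    by (intro sum.cong refl) (simp add: Suc.IH sum_distrib_right mult.assoc)
  also have "\<dots> = (\<Sum>r<n. \<theta> r ^ k * p r i * (\<Sum>l<n. p r l * M $$ (l, j)))"
    by (subst sum.swap) (simp add: sum_distrib_left)
  also have "\<dots> = (\<Sum>r<n. \<theta> r ^ Suc k * p r i * p r j)"
    using Suc.prems by (intro sum.cong refl) (simp add: ev mult_ac)
  finally show ?case .
qed

lemma mat_exp_spectral:
  assumes M: "M \<in> carrier_mat n n"
    and complete: "\<And>i j. i < n \<Longrightarrow> j < n \<Longrightarrow> (\<Sum>r<n. p r i * p r j) = of_bool (i = j)"
    and ev: "\<And>r j. r < n \<Longrightarrow> j < n \<Longrightarrow> (\<Sum>i<n. p r i * M $$ (i, j)) = \<theta> r * p r j"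
    and ij: "i < n" "j < n"
  shows "mat_exp M $$ (i, j) = (\<Sum>r<n. exp (\<theta> r) * p r i * p r j)"
proof -
  have sums: "(\<lambda>k. \<Sum>r<n. (\<theta> r ^ k /\<^sub>R fact k) * (p r i * p r j)) sums (\<Sum>r<n. exp (\<theta> r) * (p r i * p r j))"
    by (intro sums_sum sums_mult2 exp_converges)
  have "(M ^\<^sub>m k) $$ (i, j) = (\<Sum>r<n. \<theta> r ^ k * p r i * p r j)" for k
    using complete ev by (intro pow_mat_spectral[OF M _ _ ij]) auto
  then have "(\<Sum>r<n. (\<theta> r ^ k /\<^sub>R fact k) * (p r i * p r j)) = (M ^\<^sub>m k) $$ (i, j) / fact k" for k
    by (simp only: sum_divide_distrib)
      (intro sum.cong refl, simp add: scaleR_conv_of_real divide_inverse mult_ac)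
  with sums have "(\<Sum>k. (M ^\<^sub>m k) $$ (i, j) / fact k) = (\<Sum>r<n. exp (\<theta> r) * (p r i * p r j))"
    by (simp add: sums_iff)
  then show ?thesis using M ij by (simp add: mat_exp_def mult.assoc)
qed

lemma pow_mat_Ints:
  fixes M :: "'a :: comm_ring_1 mat"
  assumes M: "M \<in> carrier_mat n n"
    and Ints: "\<And>i j. i < n \<Longrightarrow> j < n \<Longrightarrow> M $$ (i, j) \<in> \<int>"
    and "i < n" "j < n"
  shows "(M ^\<^sub>m k) $$ (i, j) \<in> \<int>"
  using \<open>j < n\<close>
proof (induction k arbitrary: j)
  case 0
  then show ?case using M \<open>i < n\<close> by simp
next
  case (Suc k)
  have "(M ^\<^sub>m Suc k) $$ (i, j) = (\<Sum>l<n. (M ^\<^sub>m k) $$ (i, l) * M $$ (l, j))"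
    using M pow_carrier_mat[OF M, of k] \<open>i < n\<close> Suc.prems
    by (simp add: scalar_prod_def lessThan_atLeast0)
  also have "\<dots> \<in> \<int>"
    using Suc Ints by (intro Ints_sum Ints_mult) auto
  finally show ?case .
qed

text \<open>The characteristic polynomial is monic, and its coefficients are integers because
  \<open>M\<close> is the image of the integer matrix \<open>N\<close>.\<close>

lemma eigenvalue_algebraic_int:
  fixes M :: "real mat"
  assumes M: "M \<in> carrier_mat n n"
    and Ints: "\<And>i j. i < n \<Longrightarrow> j < n \<Longrightarrow> M $$ (i, j) \<in> \<int>"
    and ev: "eigenvalue M x"
  shows "algebraic_int x"
proof -
  define N where "N = map_mat floor M"
  have N: "N \<in> carrier_mat n n" using M by (simp add: N_def)
  have "M = map_mat of_int N"
    using M Ints by (intro eq_matI) (auto simp: N_def)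
  then have cp: "char_poly M = map_poly of_int (char_poly N)"
    by (simp add: of_int_hom.char_poly_hom[OF N])
  show ?thesis
  proof (rule algebraic_int.intros)
    show "lead_coeff (char_poly M) = 1" using degree_monic_char_poly[OF M] by auto
    show "\<forall>i. coeff (char_poly M) i \<in> \<int>" by (simp add: cp coeff_map_poly)
    show "poly (char_poly M) x = 0" using ev eigenvalue_root_char_poly[OF M] by blast
  qed
qed

subsection \<open>Spectra of graphs with a controllable vertex\<close>

text \<open>Otherwise all values lie between -2 and 2, so exactly one of these five integers is
  missed. Sum zero means that it is 0, but then the squares sum to 10.\<close>

lemma sum_squares_four_gt_six:
  fixes m :: "nat \<Rightarrow> int"
  assumes inj: "inj_on m {..<4}" and zero: "(\<Sum>r<4. m r) = 0"
  shows "6 < (\<Sum>r<4. (m r)\<^sup>2)"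
proof (rule ccontr)
  assume "\<not> ?thesis"
  then have le6: "(\<Sum>r<4. (m r)\<^sup>2) \<le> 6" by simp
  have bound: "m r \<in> {-2..2}" if "r < 4" for r
  proof -
    have "(m r)\<^sup>2 \<le> (\<Sum>r<4. (m r)\<^sup>2)" using that by (intro member_le_sum) auto
    then have "(m r)\<^sup>2 < 3\<^sup>2" using le6 by simp
    then have "\<bar>m r\<bar> < 3" by (metis abs_numeral power2_less_imp_less power2_abs abs_ge_zero zero_le_numeral)
    then show ?thesis by auto
  qed
  define K where "K = m ` {..<4}"
  have K: "K \<subseteq> {-2..2}" "card K = 4" "\<Sum>K = 0" "(\<Sum>x\<in>K. x\<^sup>2) \<le> 6"
    using bound inj zero le6 by (auto simp: K_def card_image sum.reindex)
  have "finite K" by (simp add: K_def)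
  have "card ({-2..2} - K) = 1"
    using K by (subst card_Diff_subset) (auto simp: K_def)
  then obtain x where x: "{-2..2} - K = {x}" by (auto simp: card_1_singleton_iff)
  have range: "{-2..2} = {-2, -1, 0, 1, 2 :: int}" by auto
  have split: "(\<Sum>y\<in>{-2..2}. f y) = f x + (\<Sum>y\<in>K. f y)" for f :: "int \<Rightarrow> int"
    using sum.subset_diff[OF K(1), of f] x by simp
  have "x = 0" using split[of "\<lambda>y. y"] K(3) by (simp add: range)
  then have "(\<Sum>x\<in>K. x\<^sup>2) = 10" using split[of "\<lambda>y. y\<^sup>2"] by (simp add: range)
  then show False using K(4) by simp
qed

text \<open>Multiplying the vanishing row vector \<open>y\<close> times \<open>W\<close> by a right
  inverse of \<open>W\<close> recovers \<open>y\<close>.\<close>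

lemma orthogonal_to_invertible_cols:
  fixes W :: "real mat"
  assumes W: "W \<in> carrier_mat n n" "invertible_mat W"
    and orth: "\<And>l. l < n \<Longrightarrow> (\<Sum>i<n. y i * W $$ (i, l)) = 0" and "j < n"
  shows "y j = 0"
proof -
  obtain B where B: "W * B = 1\<^sub>m n" "B * W = 1\<^sub>m (dim_row B)"
    using W unfolding invertible_mat_def inverts_mat_def by auto
  have "dim_col B = n" using arg_cong[OF B(1), of dim_col] by simp
  moreover have "dim_row B = n" using arg_cong[OF B(2), of dim_col] W by simp
  ultimately have Bc: "B \<in> carrier_mat n n" by auto
  have WB: "(\<Sum>l<n. W $$ (i, l) * B $$ (l, j)) = of_bool (i = j)" if "i < n" for i
  proof -
    have "(W * B) $$ (i, j) = (\<Sum>l<n. W $$ (i, l) * B $$ (l, j))"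
      using W Bc that \<open>j < n\<close> by (auto simp: scalar_prod_def lessThan_atLeast0)
    then show ?thesis using that \<open>j < n\<close> by (cases "i = j") (auto simp: B(1))
  qed
  have "y j = (\<Sum>i<n. if i = j then y i else 0)" using \<open>j < n\<close> by simp
  also have "\<dots> = (\<Sum>i<n. y i * (\<Sum>l<n. W $$ (i, l) * B $$ (l, j)))"
    by (intro sum.cong refl) (simp add: WB)
  also have "\<dots> = (\<Sum>i<n. \<Sum>l<n. y i * W $$ (i, l) * B $$ (l, j))"
    by (simp only: sum_distrib_left mult.assoc)
  also have "\<dots> = (\<Sum>l<n. \<Sum>i<n. y i * W $$ (i, l) * B $$ (l, j))"
    by (rule sum.swap)
  also have "\<dots> = (\<Sum>l<n. (\<Sum>i<n. y i * W $$ (i, l)) * B $$ (l, j))"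
    by (simp only: sum_distrib_right)
  also have "\<dots> = 0" by (intro sum.neutral ballI) (simp add: orth)
  finally show ?thesis .
qed

text \<open>The graph enters through its matrix on vertex indices only; \<open>p r i\<close> is
  coordinate \<open>i\<close> of the unit eigenvector for \<open>\<theta> r\<close>.\<close>

locale graph_spectrum =
  fixes n :: nat and A :: "real mat" and \<theta> :: "nat \<Rightarrow> real" and p :: "nat \<Rightarrow> nat \<Rightarrow> real"
  assumes A: "A \<in> carrier_mat n n"
    and entries: "\<And>i j. i < n \<Longrightarrow> j < n \<Longrightarrow> A $$ (i, j) \<in> {0, 1}"
    and symmetric: "\<And>i j. i < n \<Longrightarrow> j < n \<Longrightarrow> A $$ (i, j) = A $$ (j, i)"
    and diagonal: "\<And>i. i < n \<Longrightarrow> A $$ (i, i) = 0"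
    and orthonormal: "\<And>r s. r < n \<Longrightarrow> s < n \<Longrightarrow> (\<Sum>i<n. p r i * p s i) = of_bool (r = s)"
    and complete: "\<And>i j. i < n \<Longrightarrow> j < n \<Longrightarrow> (\<Sum>r<n. p r i * p r j) = of_bool (i = j)"
    and eigen: "\<And>r i. r < n \<Longrightarrow> i < n \<Longrightarrow> (\<Sum>j<n. A $$ (i, j) * p r j) = \<theta> r * p r i"
begin

lemma entries_Ints: "i < n \<Longrightarrow> j < n \<Longrightarrow> A $$ (i, j) \<in> \<int>"
  using entries[of i j] by auto

lemma left_eigen:
  assumes "r < n" "j < n"
  shows "(\<Sum>i<n. p r i * A $$ (i, j)) = \<theta> r * p r j"
proof -
  have "(\<Sum>i<n. p r i * A $$ (i, j)) = (\<Sum>i<n. A $$ (j, i) * p r i)"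
    using assms symmetric by (intro sum.cong refl) (simp add: mult.commute)
  then show ?thesis using eigen assms by simp
qed

lemma pow_entry:
  "i < n \<Longrightarrow> j < n \<Longrightarrow> (A ^\<^sub>m k) $$ (i, j) = (\<Sum>r<n. \<theta> r ^ k * p r i * p r j)"
  using complete left_eigen by (intro pow_mat_spectral[OF A]) auto

lemma trace_pow: "(\<Sum>i<n. (A ^\<^sub>m k) $$ (i, i)) = (\<Sum>r<n. \<theta> r ^ k)"
proof -
  have "(\<Sum>i<n. (A ^\<^sub>m k) $$ (i, i)) = (\<Sum>i<n. \<Sum>r<n. \<theta> r ^ k * (p r i * p r i))"
    by (intro sum.cong refl) (simp add: pow_entry mult.assoc)
  also have "\<dots> = (\<Sum>r<n. \<Sum>i<n. \<theta> r ^ k * (p r i * p r i))"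
    by (rule sum.swap)
  also have "\<dots> = (\<Sum>r<n. \<theta> r ^ k)"
    by (intro sum.cong refl) (simp add: sum_distrib_left[symmetric] orthonormal)
  finally show ?thesis .
qed

lemma sum_eigenvalues: "(\<Sum>r<n. \<theta> r) = 0"
  using trace_pow[of 1] A by (simp add: diagonal)

lemma square_entry: "i < n \<Longrightarrow> (A ^\<^sub>m 2) $$ (i, i) = (\<Sum>j<n. A $$ (i, j))"
proof -
  assume i: "i < n"
  have "(A ^\<^sub>m 2) $$ (i, i) = (\<Sum>j<n. A $$ (i, j) * A $$ (j, i))"
    using A i by (simp add: numeral_2_eq_2 scalar_prod_def lessThan_atLeast0)
  also have "\<dots> = (\<Sum>j<n. A $$ (i, j))"
  proof (intro sum.cong refl)
    fix j assume "j \<in> {..<n}"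
    then show "A $$ (i, j) * A $$ (j, i) = A $$ (i, j)"
      using entries[of i j] symmetric[of i j] i by auto
  qed
  finally show ?thesis .
qed

lemma sum_squares_eigenvalues: "(\<Sum>r<n. (\<theta> r)\<^sup>2) = (\<Sum>i<n. \<Sum>j<n. A $$ (i, j))"
  using trace_pow[of 2] by (simp add: square_entry)

lemma entry_le: "i < n \<Longrightarrow> j < n \<Longrightarrow> A $$ (i, j) \<le> of_bool (i \<noteq> j)"
  using entries[of i j] diagonal[of i] by auto

lemma sum_off_diagonal: "(\<Sum>i<n. \<Sum>j<n. of_bool (i \<noteq> j)) = real n * (real n - 1)"
proof -
  have "(\<Sum>j<n. of_bool (i \<noteq> j)) = real n - 1" if "i < n" for i
  proof -
    have "(\<Sum>j<n. of_bool (i \<noteq> j)) = (\<Sum>j<n. 1 - (if j = i then 1 else 0) :: real)"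
      by (intro sum.cong refl) auto
    then show ?thesis using that by (simp add: sum_subtractf)
  qed
  then show ?thesis by simp
qed

lemma sum_squares_eigenvalues_le: "(\<Sum>r<n. (\<theta> r)\<^sup>2) \<le> real n * (real n - 1)"
  unfolding sum_squares_eigenvalues sum_off_diagonal[symmetric]
  by (intro sum_mono entry_le) auto

text \<open>Equality forces every off-diagonal entry to be 1. An eigenvector for an eigenvalue other
  than -1 is then constant, and constant vectors alone cannot separate vertices 0 and 1.\<close>

lemma complete_graph_eigenvalue:
  assumes eq: "(\<Sum>r<n. (\<theta> r)\<^sup>2) = real n * (real n - 1)" and "n \<ge> 2"
  shows "\<exists>r<n. \<theta> r = -1"
proof (rule ccontr)
  assume no: "\<not> ?thesis"
  have "(\<Sum>i<n. \<Sum>j<n. of_bool (i \<noteq> j) - A $$ (i, j)) = 0"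
    using eq sum_squares_eigenvalues sum_off_diagonal by (simp add: sum_subtractf)
  then have "\<forall>i\<in>{..<n}. (\<Sum>j<n. of_bool (i \<noteq> j) - A $$ (i, j)) = 0"
    using entry_le by (subst (asm) sum_nonneg_eq_0_iff) (auto intro!: sum_nonneg simp del: of_bool_eq_0_iff)
  then have A_eq: "A $$ (i, j) = of_bool (i \<noteq> j)" if "i < n" "j < n" for i j
    using that entry_le sum_nonneg_eq_0_iff[of "{..<n}" "\<lambda>j. of_bool (i \<noteq> j) - A $$ (i, j)"] by force
  have ev: "(\<Sum>j<n. p r j) = (\<theta> r + 1) * p r i" if "r < n" "i < n" for r i
  proof -
    have "(\<Sum>j<n. A $$ (i, j) * p r j) = (\<Sum>j<n. p r j - (if j = i then p r j else 0))"
      using that by (intro sum.cong refl) (auto simp: A_eq)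
    also have "\<dots> = (\<Sum>j<n. p r j) - p r i"
      using that by (simp add: sum_subtractf)
    finally show ?thesis using eigen[OF that] by (simp add: distrib_right)
  qed
  have "p r 0 = p r 1" if "r < n" for r
  proof -
    have "(\<theta> r + 1) * p r 0 = (\<theta> r + 1) * p r 1"
      using ev[OF that, of 0, symmetric] ev[OF that, of 1, symmetric] \<open>n \<ge> 2\<close>
      by (simp del: mult_cancel_left)
    moreover have "\<theta> r + 1 \<noteq> 0" using no that by (metis add.commute add_eq_0_iff)
    ultimately show ?thesis by simp
  qed
  \<comment> \<open>Completeness evaluates the left side to 1 and the right side to 0.\<close>
  then have "(\<Sum>r<n. p r 0 * p r 0) = (\<Sum>r<n. p r 0 * p r 1)"
    by (intro sum.cong refl) simp
  then show False using complete[of 0 0] complete[of 0 1] \<open>n \<ge> 2\<close> by simp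
qed

text \<open>\<open>(\<theta> r)\<^sup>2\<close> is itself an eigenvalue of the integer matrix
  \<open>A ^\<^sub>m 2\<close>.\<close>

lemma algebraic_int_eigenvalue_square:
  assumes "r < n"
  shows "algebraic_int ((\<theta> r)\<^sup>2)"
proof (rule eigenvalue_algebraic_int[of "A ^\<^sub>m 2" n])
  show A2: "A ^\<^sub>m 2 \<in> carrier_mat n n" using A by (rule pow_carrier_mat)
  show "(A ^\<^sub>m 2) $$ (i, j) \<in> \<int>" if "i < n" "j < n" for i j
    using pow_mat_Ints[OF A entries_Ints] that by blast
  have "A *\<^sub>v vec n (p r) = \<theta> r \<cdot>\<^sub>v vec n (p r)"
    using A eigen[OF assms] by (intro eq_vecI) (auto simp: scalar_prod_def lessThan_atLeast0)
  moreover have "vec n (p r) \<noteq> 0\<^sub>v n"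
  proof
    assume "vec n (p r) = 0\<^sub>v n"
    then have "p r i = 0" if "i < n" for i using that by (metis index_vec index_zero_vec(1))
    then have "(\<Sum>i<n. p r i * p r i) = 0" by simp
    then show False using orthonormal[OF assms assms] by simp
  qed
  ultimately have ev: "eigenvector A (vec n (p r)) (\<theta> r)"
    using A by (simp add: eigenvector_def)
  have "eigenvector (A ^\<^sub>m 2) (vec n (p r)) ((\<theta> r)\<^sup>2)"
    using eigenvector_pow[OF A ev, of 2] ev A A2 by (simp add: eigenvector_def)
  then show "eigenvalue (A ^\<^sub>m 2) ((\<theta> r)\<^sup>2)" by (auto simp: eigenvalue_def)
qed

text \<open>The moment is the diagonal entry at \<open>u\<close> of the k-th power of
  \<open>A\<close> minus \<open>t\<close> times the identity, an integer matrix.\<close>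

lemma moments_Ints:
  assumes "u < n" and t: "t \<in> \<int>"
  shows "(\<Sum>r<n. (p r u)\<^sup>2 * (\<theta> r - t) ^ k) \<in> \<int>"
proof -
  define M where "M = mat n n (\<lambda>(i, j). A $$ (i, j) - t * of_bool (i = j))"
  have M: "M \<in> carrier_mat n n" by (simp add: M_def)
  have ev: "(\<Sum>i<n. p r i * M $$ (i, j)) = (\<theta> r - t) * p r j" if "r < n" "j < n" for r j
  proof -
    have "(\<Sum>i<n. p r i * M $$ (i, j)) = (\<Sum>i<n. p r i * A $$ (i, j) - (if i = j then t * p r i else 0))"
      using that by (intro sum.cong refl) (auto simp: M_def algebra_simps)
    also have "\<dots> = \<theta> r * p r j - t * p r j"
      using that by (simp add: sum_subtractf left_eigen)
    finally show ?thesis by (simp add: left_diff_distrib)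
  qed
  have "(M ^\<^sub>m k) $$ (u, u) = (\<Sum>r<n. (\<theta> r - t) ^ k * p r u * p r u)"
    using complete ev \<open>u < n\<close> by (intro pow_mat_spectral[OF M]) auto
  moreover have "M $$ (i, j) \<in> \<int>" if "i < n" "j < n" for i j
    using that t entries_Ints[OF that] by (auto simp: M_def)
  then have "(M ^\<^sub>m k) $$ (u, u) \<in> \<int>"
    using pow_mat_Ints[OF M] \<open>u < n\<close> by blast
  ultimately show ?thesis by (simp add: power2_eq_square mult_ac)
qed

lemma mat_exp_entry:
  assumes "i < n" "j < n"
  shows "mat_exp ((\<i> * complex_of_real \<tau>) \<cdot>\<^sub>m map_mat complex_of_real A) $$ (i, j)
    = (\<Sum>r<n. cis (\<tau> * \<theta> r) * of_real (p r i) * of_real (p r j))"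
proof -
  let ?M = "(\<i> * complex_of_real \<tau>) \<cdot>\<^sub>m map_mat complex_of_real A"
  have M: "?M \<in> carrier_mat n n" using A by simp
  have co: "(\<Sum>r<n. complex_of_real (p r i) * of_real (p r j)) = of_bool (i = j)"
    if "i < n" "j < n" for i j
    using arg_cong[OF complete[OF that], of complex_of_real] by simp
  have ev: "(\<Sum>i<n. complex_of_real (p r i) * ?M $$ (i, j)) = (\<i> * of_real \<tau> * of_real (\<theta> r)) * of_real (p r j)"
    if "r < n" "j < n" for r j
  proof -
    have "(\<Sum>i<n. complex_of_real (p r i) * ?M $$ (i, j))
        = (\<Sum>i<n. \<i> * of_real \<tau> * of_real (p r i * A $$ (i, j)))"
      using A that by (intro sum.cong refl) simp
    also have "\<dots> = \<i> * of_real \<tau> * of_real (\<Sum>i<n. p r i * A $$ (i, j))"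
      by (simp only: sum_distrib_left[symmetric] of_real_sum)
    also have "\<dots> = (\<i> * of_real \<tau> * of_real (\<theta> r)) * of_real (p r j)"
      using left_eigen[OF that] by simp
    finally show ?thesis .
  qed
  have "mat_exp ?M $$ (i, j)
      = (\<Sum>r<n. exp (\<i> * of_real \<tau> * of_real (\<theta> r)) * of_real (p r i) * of_real (p r j))"
    using mat_exp_spectral[where p = "\<lambda>r i. complex_of_real (p r i)", OF M co ev assms] .
  then show ?thesis by (simp add: cis_conv_exp mult.assoc)
qed

section \<open>Controllability against perfect state transfer\<close>

text \<open>Pairing \<open>p r\<close> with column \<open>l\<close> of the walk matrix gives
  \<open>\<theta> r ^ l * p r u\<close>. A zero at \<open>u\<close>, or a repeated eigenvalue, thus
  yields a nonzero vector orthogonal to all columns.\<close>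

lemma cyclic_vertex_spectrum:
  assumes "u < n"
    and W: "invertible_mat (mat_of_cols n (map (\<lambda>k. (A ^\<^sub>m k) *\<^sub>v unit_vec n u) [0..<n]))"
  shows "r < n \<Longrightarrow> p r u \<noteq> 0" "inj_on \<theta> {..<n}"
proof -
  define M where "M = mat_of_cols n (map (\<lambda>k. (A ^\<^sub>m k) *\<^sub>v unit_vec n u) [0..<n])"
  have M: "M \<in> carrier_mat n n" by (rule carrier_matI) (simp_all add: M_def)
  have zero: "y j = 0" if "\<And>l. l < n \<Longrightarrow> (\<Sum>i<n. y i * M $$ (i, l)) = 0" "j < n" for y j
    using orthogonal_to_invertible_cols[OF M W[folded M_def] that] .
  have entry: "M $$ (i, l) = (A ^\<^sub>m l) $$ (i, u)" if "i < n" "l < n" for i l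
    using that \<open>u < n\<close> carrier_matD[OF pow_carrier_mat[OF A, of l]]
    by (simp add: M_def mat_of_cols_def)
  have p_M: "(\<Sum>i<n. p r i * M $$ (i, l)) = \<theta> r ^ l * p r u" if r: "r < n" and l: "l < n" for r l
  proof -
    have "(\<Sum>i<n. p r i * M $$ (i, l)) = (\<Sum>i<n. p r i * (\<Sum>s<n. \<theta> s ^ l * p s i * p s u))"
      using \<open>u < n\<close> l by (intro sum.cong refl) (simp only: lessThan_iff entry pow_entry)
    also have "\<dots> = (\<Sum>i<n. \<Sum>s<n. \<theta> s ^ l * p s u * (p r i * p s i))"
      by (simp only: sum_distrib_left mult_ac)
    also have "\<dots> = (\<Sum>s<n. \<Sum>i<n. \<theta> s ^ l * p s u * (p r i * p s i))"
      by (rule sum.swap)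
    also have "\<dots> = (\<Sum>s<n. \<theta> s ^ l * p s u * of_bool (r = s))"
      using r by (intro sum.cong refl) (simp only: lessThan_iff sum_distrib_left[symmetric] orthonormal)
    also have "\<dots> = (\<Sum>s<n. if s = r then \<theta> s ^ l * p s u else 0)"
      by (intro sum.cong refl) simp
    finally show ?thesis using r by simp
  qed
  show nz: "p r u \<noteq> 0" if r: "r < n" for r
  proof
    assume "p r u = 0"
    then have "p r i = 0" if "i < n" for i
      using that by (intro zero[of "p r"]) (simp_all only: p_M[OF r] mult_zero_right)
    then have "(\<Sum>i<n. p r i * p r i) = 0" by simp
    then show False using orthonormal[OF r r] by simp
  qed
  show "inj_on \<theta> {..<n}"
  proof (rule inj_onI, rule ccontr)
    fix r s assume "r \<in> {..<n}" "s \<in> {..<n}" and eq: "\<theta> r = \<theta> s" and "r \<noteq> s"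
    then have rs: "r < n" "s < n" by auto
    \<comment> \<open>The combination of the two eigenvectors that vanishes at
      \<open>u\<close>.\<close>
    define y where "y i = p s u * p r i - p r u * p s i" for i
    have "(\<Sum>i<n. y i * M $$ (i, l)) = 0" if "l < n" for l
    proof -
      have "(\<Sum>i<n. y i * M $$ (i, l))
          = p s u * (\<Sum>i<n. p r i * M $$ (i, l)) - p r u * (\<Sum>i<n. p s i * M $$ (i, l))"
        unfolding sum_distrib_left sum_subtractf[symmetric]
        by (intro sum.cong refl) (simp only: y_def left_diff_distrib mult.assoc)
      also have "\<dots> = 0"
        unfolding p_M[OF rs(1) that] p_M[OF rs(2) that] eq by simp
      finally show ?thesis .
    qed
    then have "y i = 0" if "i < n" for i using that by (rule zero)
    then have "0 = (\<Sum>i<n. p r i * y i)" by simp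
    also have "\<dots> = p s u * (\<Sum>i<n. p r i * p r i) - p r u * (\<Sum>i<n. p r i * p s i)"
      unfolding sum_distrib_left sum_subtractf[symmetric]
      by (intro sum.cong refl) (simp add: y_def algebra_simps)
    also have "\<dots> = p s u" using orthonormal rs \<open>r \<noteq> s\<close> by simp
    finally show False using nz[OF rs(2)] by simp
  qed
qed

lemma no_state_transfer_from_cyclic_vertex:
  assumes "n \<ge> 4" "u < n" "v < n" "u \<noteq> v"
    and W: "invertible_mat (mat_of_cols n (map (\<lambda>k. (A ^\<^sub>m k) *\<^sub>v unit_vec n u) [0..<n]))"
    and transfer: "cmod (mat_exp ((\<i> * complex_of_real \<tau>) \<cdot>\<^sub>m map_mat complex_of_real A) $$ (u, v)) = 1"
  shows False
proof -
  have n0: "n > 0" using \<open>n \<ge> 4\<close> by simp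
  note nz = cyclic_vertex_spectrum(1)[OF \<open>u < n\<close> W]
  note inj_\<theta> = cyclic_vertex_spectrum(2)[OF \<open>u < n\<close> W]
  have total: "(\<Sum>r<n. (p r u)\<^sup>2) = 1" "(\<Sum>r<n. (p r v)\<^sup>2) = 1"
    using complete[of u u] complete[of v v] \<open>u < n\<close> \<open>v < n\<close> by (simp_all add: power2_eq_square)
  have unit: "cmod (\<Sum>r<n. cis (\<tau> * \<theta> r) * of_real (p r u) * of_real (p r v)) = 1"
    using transfer mat_exp_entry[OF \<open>u < n\<close> \<open>v < n\<close>] by simp
  have norm_cis: "cmod (cis (\<tau> * \<theta> r)) = 1" for r by simp
  obtain \<gamma> d where gd: "\<forall>r<n. (d r = 1 \<or> d r = -1) \<and> p r v = d r * p r u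
      \<and> cis (\<tau> * \<theta> r) = \<gamma> * of_real (d r)"
    using unit_phases_aligned[of n "\<lambda>r. cis (\<tau> * \<theta> r)" "\<lambda>r. p r u" "\<lambda>r. p r v",
        OF norm_cis total nz unit] by blast
  have d: "d r = 1 \<or> d r = -1" and v_u: "p r v = d r * p r u"
    and phase: "cis (\<tau> * \<theta> r) = \<gamma> * of_real (d r)" if "r < n" for r
    using gd that by blast+
  have "(\<Sum>r<n. d r * (p r u)\<^sup>2) = (\<Sum>r<n. p r u * p r v)"
    by (intro sum.cong refl) (simp add: v_u power2_eq_square)
  then have orth: "(\<Sum>r<n. d r * (p r u)\<^sup>2) = 0"
    using complete[OF \<open>u < n\<close> \<open>v < n\<close>] \<open>u \<noteq> v\<close> by simp
  obtain g k where grid: "\<And>r. r < n \<Longrightarrow> \<theta> r = \<theta> 0 + g * of_int (k r)"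
    and Gcd: "Gcd (k ` {..<n}) = 1" and k0: "k 0 = 0"
    and half: "(\<Sum>r | r < n \<and> odd (k r). (p r u)\<^sup>2) = 1 / 2"
    using phases_on_grid[OF phase d total(1) orth n0] by blast
  have inj_k: "inj_on k {..<n}"
  proof (rule inj_onI)
    fix r s assume rs: "r \<in> {..<n}" "s \<in> {..<n}" "k r = k s"
    then have "\<theta> r = \<theta> s" using grid[of r] grid[of s] by simp
    then show "r = s" using inj_onD[OF inj_\<theta>] rs by blast
  qed
  define T where "T = (\<Sum>r<n. (\<theta> r)\<^sup>2)"
  have T_Int: "T \<in> \<int>"
    unfolding T_def sum_squares_eigenvalues using entries_Ints by (intro Ints_sum) auto
  have T_le: "T \<le> real n * (real n - 1)"
    using sum_squares_eigenvalues_le by (simp add: T_def)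
  have "g\<^sup>2 \<in> \<int>" and \<theta>_sq: "\<And>r. r < n \<Longrightarrow> (\<theta> r)\<^sup>2 \<in> \<int>"
    using grid_square_Ints[OF grid Gcd k0 sum_eigenvalues n0 _ algebraic_int_eigenvalue_square]
      T_Int Ints_subset_Rats by (auto simp: T_def)
  then obtain N :: int where N: "g\<^sup>2 = of_int N" by (auto elim: Ints_cases)
  have "g \<noteq> 0"
  proof
    assume "g = 0"
    then have "\<theta> 1 = \<theta> 0" using grid[of 1] \<open>n \<ge> 4\<close> by simp
    then show False using inj_onD[OF inj_\<theta>, of 1 0] \<open>n \<ge> 4\<close> by auto
  qed
  then have "of_int N > (0 :: real)" unfolding N[symmetric] by simp
  then have N_pos: "N > 0" by simp
  have bound: "of_int N * ((real n)\<^sup>2 * ((real n)\<^sup>2 - 1)) \<le> 12 * real n * T"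
    using grid_square_bound[OF grid inj_k sum_eigenvalues] by (simp add: N T_def)
  \<comment> \<open>With \<open>T\<close> at most that of the complete graph, the positive factor
    \<open>n\<^sup>2 * (n - 1)\<close> cancels.\<close>
  have Nn: "N * (int n + 1) \<le> 12"
  proof -
    have "of_int N * ((real n)\<^sup>2 * ((real n)\<^sup>2 - 1)) \<le> 12 * real n * (real n * (real n - 1))"
      using T_le by (intro order_trans[OF bound] mult_left_mono) auto
    then have "((real n)\<^sup>2 * (real n - 1)) * (of_int N * (real n + 1)) \<le> ((real n)\<^sup>2 * (real n - 1)) * 12"
      by (simp add: power2_eq_square algebra_simps)
    moreover have "(real n)\<^sup>2 * (real n - 1) > 0" using \<open>n \<ge> 4\<close> by simp
    ultimately have "of_int N * (real n + 1) \<le> 12" by (simp only: mult_le_cancel_left_pos)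
    then have "real_of_int (N * (int n + 1)) \<le> of_int 12" by simp
    then show ?thesis by (simp only: of_int_le_iff)
  qed
  obtain q where q_Rat: "\<And>r. r < n \<Longrightarrow> q r \<in> \<rat>" and \<theta>_q: "\<And>r. r < n \<Longrightarrow> \<theta> r = g * q r"
    using grid_rational[OF grid sum_eigenvalues n0] by blast
  have "N \<noteq> 1"
  proof
    assume "N = 1"
    then have g: "g = 1 \<or> g = -1" using N by (simp add: power2_eq_1_iff)
    have "\<theta> r \<in> \<int>" if "r < n" for r
    proof (rule Ints_if_square_Ints[OF _ \<theta>_sq[OF that]])
      show "\<theta> r \<in> \<rat>" using q_Rat[OF that] \<theta>_q[OF that] g by auto
    qed
    then have "\<theta> 0 \<in> \<int>" using n0 by simp
    \<comment> \<open>The sign of \<open>g\<close> is absorbed into the integers, which leaves their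
      parities unchanged.\<close>
    define s where "s = (if g = 1 then 1 else -1 :: int)"
    have gs: "g = of_int s" using g by (auto simp: s_def)
    have odd_s: "odd (s * k r) \<longleftrightarrow> odd (k r)" for r by (simp add: s_def)
    have \<mu>: "\<theta> r - \<theta> 0 = of_int (s * k r)" if "r < n" for r
      using grid[OF that] gs by simp
    show False
    proof (rule no_half_odd_weight[of "\<lambda>r. s * k r" n "\<lambda>r. (p r u)\<^sup>2"])
      show "inj_on (\<lambda>r. s * k r) {..<n}"
        using inj_k by (auto simp: inj_on_def s_def)
      show "(\<Sum>r<n. (p r u)\<^sup>2 * of_int (s * k r) ^ j) \<in> \<int>" for j
      proof -
        have "(\<Sum>r<n. (p r u)\<^sup>2 * of_int (s * k r) ^ j) = (\<Sum>r<n. (p r u)\<^sup>2 * (\<theta> r - \<theta> 0) ^ j)"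
          by (intro sum.cong refl) (simp only: \<mu> lessThan_iff)
        then show ?thesis using moments_Ints[OF \<open>u < n\<close> \<open>\<theta> 0 \<in> \<int>\<close>] by simp
      qed
      show "(\<Sum>r | r < n \<and> odd (s * k r). (p r u)\<^sup>2) = 1 / 2"
        unfolding odd_s by (rule half)
    qed (rule total(1))
  qed
  moreover have "N \<le> 2"
  proof (rule ccontr)
    assume "\<not> ?thesis"
    then have "3 * (int n + 1) \<le> N * (int n + 1)" by (intro mult_right_mono) auto
    then show False using Nn \<open>n \<ge> 4\<close> by simp
  qed
  ultimately have N2: "N = 2" using N_pos by simp
  have q_Int: "q r \<in> \<int>" if r: "r < n" for r
  proof -
    obtain z :: int where z: "(\<theta> r)\<^sup>2 = of_int z" using \<theta>_sq[OF r] by (auto elim: Ints_cases)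
    have zq: "2 * (q r)\<^sup>2 = of_int z"
      using z \<theta>_q[OF r] N N2 by (simp add: power_mult_distrib)
    \<comment> \<open>Since only \<open>2 * (q r)\<^sup>2\<close> is known to be an integer,
      \<open>2 * q r\<close> is shown to be one first; its square is even, so it is even
      itself.\<close>
    then have sq: "(2 * q r)\<^sup>2 = of_int (2 * z)" by (simp add: power_mult_distrib)
    have "2 * q r \<in> \<int>"
    proof (rule Ints_if_square_Ints)
      show "2 * q r \<in> \<rat>" by (intro Rats_mult Rats_number_of q_Rat r)
      show "(2 * q r)\<^sup>2 \<in> \<int>" unfolding sq by (rule Ints_of_int)
    qed
    then obtain y :: int where y: "2 * q r = of_int y" by (rule Ints_cases)
    have "real_of_int (y\<^sup>2) = of_int (2 * z)"
      unfolding of_int_power y[symmetric] by (rule sq)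
    then have "y\<^sup>2 = 2 * z" by (simp only: of_int_eq_iff)
    then have "even (y\<^sup>2)" by simp
    then have "even y" by simp
    then obtain x where "y = 2 * x" by (rule dvdE)
    then have "q r = of_int x" using y by simp
    then show ?thesis by simp
  qed
  then have "\<forall>r<n. \<exists>z::int. q r = of_int z" by (auto elim: Ints_cases)
  then obtain m :: "nat \<Rightarrow> int" where m: "\<And>r. r < n \<Longrightarrow> q r = of_int (m r)" by metis
  have \<theta>_m: "\<theta> r = g * of_int (m r)" if "r < n" for r using \<theta>_q m that by simp
  have \<theta>_m_sq: "(\<theta> r)\<^sup>2 = 2 * of_int ((m r)\<^sup>2)" if "r < n" for r
    using \<theta>_m[OF that] N N2 by (simp add: power_mult_distrib)
  have T_m: "T = 2 * of_int (\<Sum>r<n. (m r)\<^sup>2)"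
    unfolding T_def of_int_sum sum_distrib_left by (intro sum.cong refl) (simp only: \<theta>_m_sq lessThan_iff)
  have "n = 4 \<or> n = 5" using Nn N2 \<open>n \<ge> 4\<close> by auto
  then show False
  proof
    assume "n = 4"
    have "g * of_int (\<Sum>r<n. m r) = (\<Sum>r<n. \<theta> r)"
      unfolding of_int_sum sum_distrib_left by (intro sum.cong refl) (simp only: \<theta>_m lessThan_iff)
    then have "real_of_int (\<Sum>r<n. m r) = 0"
      using sum_eigenvalues \<open>g \<noteq> 0\<close> by (simp only: mult_eq_0_iff simp_thms)
    then have "(\<Sum>r<n. m r) = 0" by (simp only: of_int_eq_0_iff)
    moreover have "inj_on m {..<n}"
    proof (rule inj_onI)
      fix r s assume rs: "r \<in> {..<n}" "s \<in> {..<n}" "m r = m s"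
      then have "\<theta> r = \<theta> s" using \<theta>_m[of r] \<theta>_m[of s] by simp
      then show "r = s" using inj_onD[OF inj_\<theta>] rs by blast
    qed
    ultimately have "6 < (\<Sum>r<n. (m r)\<^sup>2)"
      using sum_squares_four_gt_six[of m] by (simp only: \<open>n = 4\<close>)
    then have "real_of_int 6 < of_int (\<Sum>r<n. (m r)\<^sup>2)" by (simp only: of_int_less_iff)
    moreover have "T \<le> 12" using T_le by (simp add: \<open>n = 4\<close>)
    ultimately show False unfolding T_m by simp
  next
    assume "n = 5"
    \<comment> \<open>The spread bound reads 2 * 25 * 24 \<le> 60 * \<open>T\<close>, which matches
      the upper bound \<open>n * (n - 1)\<close> exactly and so forces the complete graph.\<close>
    have "T \<ge> 20" using bound by (simp add: N2 \<open>n = 5\<close>)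
    moreover have "T \<le> 20" using T_le by (simp add: \<open>n = 5\<close>)
    ultimately have "(\<Sum>r<n. (\<theta> r)\<^sup>2) = real n * (real n - 1)"
      unfolding T_def[symmetric] by (simp add: \<open>n = 5\<close>)
    then obtain r where r: "r < n" "\<theta> r = -1"
      using complete_graph_eigenvalue \<open>n \<ge> 4\<close> by auto
    then have "2 * real_of_int ((m r)\<^sup>2) = 1" using \<theta>_m_sq[OF r(1)] by simp
    then have "real_of_int (2 * (m r)\<^sup>2) = of_int 1" by simp
    then have "2 * (m r)\<^sup>2 = 1" by (simp only: of_int_eq_iff)
    then show False by (metis dvd_triv_left odd_one)
  qed
qed

end

section \<open>From vertex indices back to graphs\<close>

lemma vertex_index:
  assumes "distinct vs" "w \<in> set vs"
  shows "vertex_index vs w < length vs" "vs ! vertex_index vs w = w"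
proof -
  obtain i where "i < length vs" "w = vs ! i"
    using assms(2) by (auto simp: in_set_conv_nth)
  then show "vertex_index vs w < length vs" "vs ! vertex_index vs w = w"
    using vertex_index_nth[OF assms(1)] by simp_all
qed

lemma graph_spectrum_adjacency_mat:
  assumes "pair_graph G"
  obtains \<theta> p where "graph_spectrum (length vs) (adjacency_mat vs G) \<theta> p"
proof -
  interpret pair_graph G by fact
  let ?n = "length vs" and ?A = "adjacency_mat vs G"
  have A: "?A \<in> carrier_mat ?n ?n"
    by (simp add: adjacency_mat_def)
  have entries: "?A $$ (i, j) \<in> {0, 1}" if "i < ?n" "j < ?n" for i j
    using that by (simp add: adjacency_mat_def)
  have sym: "?A $$ (i, j) = ?A $$ (j, i)" if "i < ?n" "j < ?n" for i j
    using that arcs_symmetric[of "vs ! i" "vs ! j"] arcs_symmetric[of "vs ! j" "vs ! i"]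
    by (auto simp: adjacency_mat_def)
  have diag: "?A $$ (i, i) = 0" if "i < ?n" for i
    using that no_loops'[of "vs ! i" "vs ! i"] by (auto simp: adjacency_mat_def)
  show thesis
  proof (rule symmetric_spectral_decomposition[of ?n "\<lambda>i j. ?A $$ (i, j)", OF sym])
    fix p \<theta>
    assume "\<And>r s. r < ?n \<Longrightarrow> s < ?n \<Longrightarrow> (\<Sum>i<?n. p r i * p s i) = of_bool (r = s)"
      and "\<And>i j. i < ?n \<Longrightarrow> j < ?n \<Longrightarrow> (\<Sum>r<?n. p r i * p r j) = of_bool (i = j)"
      and "\<And>r i. r < ?n \<Longrightarrow> i < ?n \<Longrightarrow> (\<Sum>j<?n. ?A $$ (i, j) * p r j) = \<theta> r * p r i"
    from that[OF graph_spectrum.intro, OF A entries sym diag this] show thesis .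
  qed
qed

theorem theorem7p4:
  fixes G :: "'a pair_pre_digraph" and vs :: "'a list" and u v :: 'a
  assumes "pair_graph G"
    and "Digraph_Component.connected (with_proj G)"
    and "card (pverts G) \<ge> 4"
    and "distinct vs" and "set vs = pverts G"
    and "u \<in> pverts G" and "v \<in> pverts G" and "u \<noteq> v"
    and "perfect_state_transfer vs G u v"
  shows "\<not> controllable vs G u \<and> \<not> controllable vs G v"
proof -
  let ?n = "length vs" and ?u = "vertex_index vs u" and ?v = "vertex_index vs v"
  obtain \<theta> p where "graph_spectrum ?n (adjacency_mat vs G) \<theta> p"
    using graph_spectrum_adjacency_mat[OF assms(1)] .
  then interpret graph_spectrum ?n "adjacency_mat vs G" \<theta> p .
  have n: "?n \<ge> 4" using assms(3) distinct_card[OF assms(4)] by (simp add: assms(5))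
  note u = vertex_index[of vs u, unfolded assms(5), OF assms(4,6)]
  note v = vertex_index[of vs v, unfolded assms(5), OF assms(4,7)]
  have uv: "?u < ?n" "?v < ?n" "?u \<noteq> ?v"
    using u v assms(8) by auto
  obtain \<tau> where \<tau>: "cmod (transition_mat vs G \<tau> $$ (?u, ?v)) = 1"
    using assms(9) by (auto simp: perfect_state_transfer_def)
  \<comment> \<open>The transition matrix is symmetric, so transfer also runs from \<open>v\<close>
    to \<open>u\<close> and the one-sided lemma applies to both vertices.\<close>
  have "transition_mat vs G \<tau> $$ (?u, ?v) = transition_mat vs G \<tau> $$ (?v, ?u)"
    unfolding transition_mat_def mat_exp_entry[OF uv(1,2)] mat_exp_entry[OF uv(2,1)]
    by (simp only: mult_ac)
  with \<tau> have \<tau>': "cmod (transition_mat vs G \<tau> $$ (?v, ?u)) = 1" by simp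
  show ?thesis
    unfolding controllable_def walk_mat_def
  proof (intro conjI notI)
    let ?W = "\<lambda>w. mat_of_cols ?n (map (\<lambda>k. (adjacency_mat vs G ^\<^sub>m k) *\<^sub>v unit_vec ?n w) [0..<?n])"
    show False if "invertible_mat (?W ?u)"
      by (rule no_state_transfer_from_cyclic_vertex[OF n uv(1,2,3) that \<tau>[unfolded transition_mat_def]])
    show False if "invertible_mat (?W ?v)"
      by (rule no_state_transfer_from_cyclic_vertex[OF n uv(2,1) uv(3)[symmetric] that \<tau>'[unfolded transition_mat_def]])
  qed
qed

end
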